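(* Let $\mathcal{A}$ be a properly infinite von Neumann algebra and let $T,S\in\mathcal{A}$. For $C\in\mathcal{A}$ put $M_C=\begin{pmatrix} T & C\\ 0 & S\end{pmatrix}\in M_2(\mathcal{A})$. If $C\in\mathcal{A}$ is such that the inclusion $\sigma_{ef}(M_C)\subset\sigma_{ef}(T)\cup\sigma_{ef}(S)$ is proper, then $$\sigma_{ef}(T)\cup\sigma_{ef}(S)=\sigma_{ef}(M_C)\cup\bigl(\sigma_{ef}(T)\cap\sigma_{ef}(S)\bigr).$$
   Context: $\mathcal{A}$ acts on a Hilbert space $H$, and $M_2(\mathcal{A})$ is the (again properly infinite) von Neumann algebra of $2\times 2$ matrices over $\mathcal{A}$, acting on $H\oplus H$. Projections are orthogonal projections. For a closed subspace $L$, $P_L$ is the orthogonal projection onto $L$. A projection of a von Neumann algebra is finite if it is not Murray–von Neumann equivalent (in that algebra) to any of its proper subprojections. An element $X$ of a properly infinite von Neumann algebra $\mathcal{B}$ is called $\mathcal{B}$-Fredholm (in the sense of Breuer) if (i) $P_{\ker X}$ is a finite projection of $\mathcal{B}$, and (ii) there is a finite projection $E\in\mathcal{B}$ with $\operatorname{Im}(I-E)\subseteq\operatorname{Im}X$. For $X\in\mathcal{A}$, $\sigma_{ef}(X)=\{\lambda\in\mathbb{C}: X-\lambda I \text{ is not } \mathcal{A}\text{-Fredholm}\}$. For $X\in M_2(\mathcal{A})$, $\sigma_{ef}(X)=\{\lambda\in\mathbb{C}: X-\lambda I\text{ is not } M_2(\mathcal{A})\text{-Fredholm}\}$. *)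

theory Defs
  imports "HOL-Analysis.Analysis"
begin

text \<open>
  The library has real inner product spaces only.  A complex Hilbert space is a complete real
  inner product space carrying a compatible complex scalar multiplication and a sesquilinear form
  (linear in the first argument) whose real part is the real inner product, so that the norm is
  the one induced by the complex inner product.
\<close>

class chilbert_space = real_inner + banach +
  fixes scaleC :: "complex \<Rightarrow> 'a \<Rightarrow> 'a"  (infixr "*\<^sub>C" 75)
    and cinner :: "'a \<Rightarrow> 'a \<Rightarrow> complex"
  assumes scaleC_add_right: "c *\<^sub>C (x + y) = c *\<^sub>C x + c *\<^sub>C y"
    and scaleC_add_left: "(c + d) *\<^sub>C x = c *\<^sub>C x + d *\<^sub>C x"
    and scaleC_scaleC: "c *\<^sub>C (d *\<^sub>C x) = (c * d) *\<^sub>C x"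
    and scaleC_of_real: "complex_of_real r *\<^sub>C x = r *\<^sub>R x"
    and cinner_commute: "cinner x y = cnj (cinner y x)"
    and cinner_add_left: "cinner (x + y) z = cinner x z + cinner y z"
    and cinner_scaleC_left: "cinner (c *\<^sub>C x) y = c * cinner x y"
    and inner_eq_Re_cinner: "inner x y = Re (cinner x y)"

text \<open>The Hilbert space direct sum is the product type with its library norm.\<close>

instantiation prod :: (chilbert_space, chilbert_space) chilbert_space
begin

definition scaleC_prod_def: "c *\<^sub>C p = (c *\<^sub>C fst p, c *\<^sub>C snd p)"

definition cinner_prod_def: "cinner p q = cinner (fst p) (fst q) + cinner (snd p) (snd q)"

instance
proof
  fix c d :: complex and r :: real and x y z :: "'a \<times> 'b"
  show "c *\<^sub>C (x + y) = c *\<^sub>C x + c *\<^sub>C y"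
    by (simp add: scaleC_prod_def scaleC_add_right)
  show "(c + d) *\<^sub>C x = c *\<^sub>C x + d *\<^sub>C x"
    by (simp add: scaleC_prod_def scaleC_add_left)
  show "c *\<^sub>C (d *\<^sub>C x) = (c * d) *\<^sub>C x"
    by (simp add: scaleC_prod_def scaleC_scaleC)
  show "complex_of_real r *\<^sub>C x = r *\<^sub>R x"
    by (simp add: scaleC_prod_def scaleC_of_real scaleR_prod_def)
  show "cinner x y = cnj (cinner y x)"
    unfolding cinner_prod_def complex_cnj_add
    by (simp only: cinner_commute[symmetric])
  show "cinner (x + y) z = cinner x z + cinner y z"
    by (simp add: cinner_prod_def cinner_add_left)
  show "cinner (c *\<^sub>C x) y = c * cinner x y"
    by (simp add: cinner_prod_def scaleC_prod_def cinner_scaleC_left distrib_left)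
  show "inner x y = Re (cinner x y)"
    by (simp add: cinner_prod_def inner_prod_def inner_eq_Re_cinner)
qed

end

definition bounded_ops :: "('h::chilbert_space \<Rightarrow> 'h) set" where
  "bounded_ops = {X. bounded_linear X \<and> (\<forall>c x. X (c *\<^sub>C x) = c *\<^sub>C X x)}"

definition cadjoint :: "('h::chilbert_space \<Rightarrow> 'h) \<Rightarrow> 'h \<Rightarrow> 'h" where
  "cadjoint X = (THE Y. \<forall>x y. cinner (X x) y = cinner x (Y y))"

text \<open>Only meaningful when \<open>L\<close> is a closed complex subspace.\<close>

definition orth_proj :: "'h::chilbert_space set \<Rightarrow> 'h \<Rightarrow> 'h" where
  "orth_proj L x = (THE y. y \<in> L \<and> (\<forall>z\<in>L. cinner (x - y) z = 0))"

definition commutant :: "('h::chilbert_space \<Rightarrow> 'h) set \<Rightarrow> ('h \<Rightarrow> 'h) set" where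
  "commutant M = {X \<in> bounded_ops. \<forall>Y\<in>M. X \<circ> Y = Y \<circ> X}"

definition star_subalgebra :: "('h::chilbert_space \<Rightarrow> 'h) set \<Rightarrow> bool" where
  "star_subalgebra A \<longleftrightarrow>
     A \<subseteq> bounded_ops \<and>
     id \<in> A \<and>
     (\<forall>X\<in>A. \<forall>Y\<in>A. (\<lambda>x. X x + Y x) \<in> A) \<and>
     (\<forall>c. \<forall>X\<in>A. (\<lambda>x. c *\<^sub>C X x) \<in> A) \<and>
     (\<forall>X\<in>A. \<forall>Y\<in>A. X \<circ> Y \<in> A) \<and>
     (\<forall>X\<in>A. cadjoint X \<in> A)"

text \<open>Dixmier's definition: a *-subalgebra of the bounded operators equal to its bicommutant.\<close>

definition von_neumann_algebra :: "('h::chilbert_space \<Rightarrow> 'h) set \<Rightarrow> bool" where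
  "von_neumann_algebra A \<longleftrightarrow> star_subalgebra A \<and> commutant (commutant A) = A"

definition projections :: "('h::chilbert_space \<Rightarrow> 'h) set \<Rightarrow> ('h \<Rightarrow> 'h) set" where
  "projections A = {E \<in> A. E \<circ> E = E \<and> cadjoint E = E}"

definition mvn_equiv ::
    "('h::chilbert_space \<Rightarrow> 'h) set \<Rightarrow> ('h \<Rightarrow> 'h) \<Rightarrow> ('h \<Rightarrow> 'h) \<Rightarrow> bool" where
  "mvn_equiv A E F \<longleftrightarrow> (\<exists>V\<in>A. cadjoint V \<circ> V = E \<and> V \<circ> cadjoint V = F)"

definition finite_projection :: "('h::chilbert_space \<Rightarrow> 'h) set \<Rightarrow> ('h \<Rightarrow> 'h) \<Rightarrow> bool" where
  "finite_projection A E \<longleftrightarrow>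
     E \<in> projections A \<and>
     \<not> (\<exists>F\<in>projections A. range F \<subseteq> range E \<and> F \<noteq> E \<and> mvn_equiv A E F)"

text \<open>
  The zero projection is always finite.  With this convention (Dixmier's) the zero algebra counts
  as properly infinite.
\<close>

definition properly_infinite :: "('h::chilbert_space \<Rightarrow> 'h) set \<Rightarrow> bool" where
  "properly_infinite A \<longleftrightarrow>
     (\<forall>E. finite_projection A E \<and> E \<in> commutant A \<longrightarrow> E = (\<lambda>_. 0))"

definition op_matrix ::
    "('h::chilbert_space \<Rightarrow> 'h) \<Rightarrow> ('h \<Rightarrow> 'h) \<Rightarrow> ('h \<Rightarrow> 'h) \<Rightarrow> ('h \<Rightarrow> 'h) \<Rightarrow> 'h \<times> 'h \<Rightarrow> 'h \<times> 'h" where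
  "op_matrix X11 X12 X21 X22 = (\<lambda>(x, y). (X11 x + X12 y, X21 x + X22 y))"

definition matrix_algebra ::
    "('h::chilbert_space \<Rightarrow> 'h) set \<Rightarrow> ('h \<times> 'h \<Rightarrow> 'h \<times> 'h) set" where
  "matrix_algebra A =
     {op_matrix X11 X12 X21 X22 | X11 X12 X21 X22. X11 \<in> A \<and> X12 \<in> A \<and> X21 \<in> A \<and> X22 \<in> A}"

definition fredholm :: "('h::chilbert_space \<Rightarrow> 'h) set \<Rightarrow> ('h \<Rightarrow> 'h) \<Rightarrow> bool" where
  "fredholm B X \<longleftrightarrow>
     X \<in> B \<and>
     finite_projection B (orth_proj {x. X x = 0}) \<and>
     (\<exists>E. finite_projection B E \<and> range (\<lambda>x. x - E x) \<subseteq> range X)"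

definition sigma_ef :: "('h::chilbert_space \<Rightarrow> 'h) set \<Rightarrow> ('h \<Rightarrow> 'h) \<Rightarrow> complex set" where
  "sigma_ef B X = {c. \<not> fredholm B (\<lambda>x. X x - c *\<^sub>C x)}"

end

theory Submission
  imports Defs
begin

text \<open>
  The properties "\<open>T\<close> Fredholm", "\<open>S\<close> Fredholm" and "\<open>M\<^sub>C\<close> Fredholm" are such that
  the last one and any one of the other two imply the third.  A projection of the algebra is replaced
  by its range, a closed subspace invariant under the commutant.  The
  basic tool is an extension property: if \<open>X\<close> in the algebra maps \<open>L\<close> into a finite \<open>L'\<close> and
  \<open>L \<inter> ker X\<close> is finite, then \<open>L\<close> is finite.  It contains both the polar decomposition
  (injective \<open>X\<close>) and the finiteness of sums of finite projections.  All kernels and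
  cokernels are estimated with it; for instance \<open>ker S\<close> is mapped by \<open>C\<close> into the cokernel of
  \<open>T\<close>, and what is killed embeds into \<open>ker M\<^sub>C\<close>.  The range of \<open>T\<close> needs more: \<open>M\<^sub>C\<close>
  only shows that \<open>ran T + C (ker S)\<close> is large.  By uniform boundedness \<open>T*\<close> is then bounded below
  on a cofinite subspace \<open>J\<close>, and \<open>T T* J\<close> is a closed cofinite subspace of \<open>ran T\<close>.
\<close>

section \<open>Complex Hilbert spaces\<close>


text \<open>The spectrum of the matrix lies in the union by assumption, so the work is at a point of
  the union outside that spectrum: if one diagonal entry, shifted by this point, were Fredholm, the
  other would be too, against membership in the union. Hence only the two implications that start
  from a Fredholm matrix are proved. Two obstacles shape the proof. Fredholm elements need not have
  closed range, so closed cofinite subspaces inside ranges have to be exhibited. And no dimension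
  function is used, so finiteness must be transported by operators of the algebra; the test by
  isometries of a subspace into itself moves along isometries in the algebra, and polar
  decomposition, which needs a single square root, reduces injective operators to isometries. Sums
  are the hard case: an isometry of a sum need not respect the summands. Comparison up to a central
  projection sorts its wandering subspaces into pieces that fit into one summand.\<close>

lemma cinner_add_right: "cinner x (y + z) = cinner x y + cinner x z"
  by (metis cinner_add_left cinner_commute complex_cnj_add)

lemma cinner_scaleC_right: "cinner x (c *\<^sub>C y) = cnj c * cinner x y"
  by (metis cinner_scaleC_left cinner_commute complex_cnj_mult)

lemma scaleC_zero_right [simp]: "c *\<^sub>C (0::'a::chilbert_space) = 0"
  using scaleC_add_right[of c "0::'a" 0] by simp

lemma scaleC_zero_left [simp]: "0 *\<^sub>C x = 0"
  using scaleC_add_left[of 0 0 x] by simp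

lemma scaleC_one [simp]: "1 *\<^sub>C x = x"
  using scaleC_of_real[of 1 x] by simp

lemma scaleC_minus_one: "(-1) *\<^sub>C x = - x"
  using scaleC_of_real[of "-1" x] by simp

lemma scaleC_minus_right: "c *\<^sub>C (- x) = - (c *\<^sub>C x)"
  using scaleC_add_right[of c x "-x"] by (simp add: eq_neg_iff_add_eq_0 add.commute)

lemma scaleC_diff_right: "c *\<^sub>C (x - y) = c *\<^sub>C x - c *\<^sub>C y"
  using scaleC_add_right[of c x "-y"] by (simp add: scaleC_minus_right)

lemma cinner_zero_left [simp]: "cinner 0 x = 0"
  using cinner_scaleC_left[of 0 0 x] by simp

lemma cinner_zero_right [simp]: "cinner x 0 = 0"
  using cinner_scaleC_right[of x 0 0] by simp

lemma cinner_minus_left: "cinner (- x) y = - cinner x y"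
  using cinner_scaleC_left[of "-1" x y] by (simp add: scaleC_minus_one)

lemma cinner_minus_right: "cinner x (- y) = - cinner x y"
  using cinner_scaleC_right[of x "-1" y] by (simp add: scaleC_minus_one)

lemma cinner_diff_left: "cinner (x - y) z = cinner x z - cinner y z"
  using cinner_add_left[of x "-y" z] by (simp add: cinner_minus_left)

lemma cinner_diff_right: "cinner x (y - z) = cinner x y - cinner x z"
  using cinner_add_right[of x y "-z"] by (simp add: cinner_minus_right)

lemmas cinner_simps = cinner_add_left cinner_add_right cinner_diff_left cinner_diff_right
  cinner_minus_left cinner_minus_right cinner_scaleC_left cinner_scaleC_right

lemma Im_cinner: "Im (cinner x y) = inner x (\<i> *\<^sub>C y)"
  by (simp add: inner_eq_Re_cinner cinner_scaleC_right)

lemma cinner_eq_inner: "cinner x y = Complex (inner x y) (inner x (\<i> *\<^sub>C y))"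
  by (simp add: complex_eq_iff Im_cinner inner_eq_Re_cinner)

lemma cinner_self: "cinner x x = complex_of_real ((norm x)\<^sup>2)"
proof -
  have "Im (cinner x x) = 0"
    using arg_cong[OF cinner_commute[of x x], of Im] by simp
  then show ?thesis
    by (simp add: complex_eq_iff power2_norm_eq_inner inner_eq_Re_cinner)
qed

lemma cinner_self_eq_zero [simp]: "cinner x x = 0 \<longleftrightarrow> x = 0"
  by (simp add: cinner_self)

lemma norm_scaleC: "norm (c *\<^sub>C x) = cmod c * norm x"
proof -
  have "complex_of_real ((norm (c *\<^sub>C x))\<^sup>2) = (c * cnj c) * cinner x x"
    by (simp only: cinner_self[symmetric] cinner_scaleC_left cinner_scaleC_right mult.assoc mult.left_commute)
  also have "\<dots> = complex_of_real ((cmod c * norm x)\<^sup>2)"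
    by (simp only: cinner_self complex_norm_square[symmetric] power_mult_distrib of_real_mult)
  finally have "(norm (c *\<^sub>C x))\<^sup>2 = (cmod c * norm x)\<^sup>2"
    using of_real_eq_iff by blast
  then show ?thesis
    by (simp add: power2_eq_iff_nonneg)
qed

lemma cmod_cinner_le: "cmod (cinner x y) \<le> norm x * norm y"
proof (cases "cinner x y = 0")
  case False
  \<comment> \<open>The phase that makes the product real and nonnegative, so that the real
    Cauchy-Schwarz inequality applies.\<close>
  define u where "u = cnj (cinner x y) / cmod (cinner x y)"
  have u: "cmod u = 1" "u * cinner x y = cmod (cinner x y)"
  proof -
    show "cmod u = 1"
      using False by (simp add: u_def norm_divide)
    have "u * cinner x y = complex_of_real ((cmod (cinner x y))\<^sup>2) / complex_of_real (cmod (cinner x y))"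
      unfolding complex_norm_square by (simp add: u_def)
    then show "u * cinner x y = cmod (cinner x y)"
      using False by (simp add: power2_eq_square)
  qed
  have "cmod (cinner x y) = inner (u *\<^sub>C x) y"
    by (simp add: inner_eq_Re_cinner cinner_scaleC_left u)
  also have "\<dots> \<le> norm (u *\<^sub>C x) * norm y"
    by (rule norm_cauchy_schwarz)
  finally show ?thesis
    by (simp add: norm_scaleC u)
qed simp

lemma cinner_ext: "(\<And>z. cinner x z = cinner y z) \<Longrightarrow> x = y"
  by (metis cinner_diff_left cinner_self_eq_zero right_minus_eq)

lemma cinner_ext_right: "(\<And>z. cinner z x = cinner z y) \<Longrightarrow> x = y"
  by (metis cinner_diff_right cinner_self_eq_zero right_minus_eq)

lemma cinner_eq_zero_commute: "cinner x y = 0 \<longleftrightarrow> cinner y x = 0"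
  by (metis cinner_commute complex_cnj_zero)

lemma bounded_linear_scaleC: "bounded_linear (\<lambda>x. c *\<^sub>C x)"
proof (rule bounded_linear_intro)
  show "c *\<^sub>C (r *\<^sub>R x) = r *\<^sub>R (c *\<^sub>C x)" for r x
    by (simp add: scaleC_of_real[symmetric] scaleC_scaleC mult.commute)
  show "norm (c *\<^sub>C x) \<le> norm x * cmod c" for x
    by (simp add: norm_scaleC mult.commute)
qed (simp add: scaleC_add_right)

lemma bounded_linear_cinner_left: "bounded_linear (\<lambda>x. cinner x y)"
proof (rule bounded_linear_intro[where K="norm y"])
  show "cinner (r *\<^sub>R x) y = r *\<^sub>R cinner x y" for r x
    by (simp add: scaleC_of_real[symmetric] cinner_scaleC_left scaleR_conv_of_real)
qed (auto simp: cinner_add_left cmod_cinner_le)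

lemma bounded_linear_cinner_right: "bounded_linear (\<lambda>y. cinner x y)"
proof (rule bounded_linear_intro)
  show "cinner x (r *\<^sub>R y) = r *\<^sub>R cinner x y" for r y
    by (simp add: scaleC_of_real[symmetric] cinner_scaleC_right scaleR_conv_of_real)
  show "norm (cinner x y) \<le> norm y * norm x" for y
    by (metis cmod_cinner_le mult.commute)
qed (auto simp: cinner_add_right)

lemmas continuous_on_cinner_left [continuous_intros] =
  bounded_linear.continuous_on[OF bounded_linear_cinner_left]
lemmas continuous_on_cinner_right [continuous_intros] =
  bounded_linear.continuous_on[OF bounded_linear_cinner_right]

lemma bounded_opsD:
  assumes "X \<in> bounded_ops"
  shows "bounded_linear X" "X (x + y) = X x + X y" "X (x - y) = X x - X y" "X (- x) = - X x"
    "X 0 = 0" "X (c *\<^sub>C x) = c *\<^sub>C X x" "X (r *\<^sub>R x) = r *\<^sub>R X x"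
  using assms unfolding bounded_ops_def
  by (auto dest: bounded_linear.linear simp: linear_add linear_diff linear_neg linear_0 linear_cmul)

lemma bounded_opsI:
  assumes "\<And>x y. X (x + y) = X x + X y" "\<And>c x. X (c *\<^sub>C x) = c *\<^sub>C X x"
    "\<And>x. norm (X x) \<le> norm x * K"
  shows "X \<in> bounded_ops"
proof -
  have "bounded_linear X"
    by (rule bounded_linear_intro[where K=K]) (simp_all add: assms flip: scaleC_of_real)
  then show ?thesis
    by (simp add: bounded_ops_def assms)
qed

text \<open>Polarization recovers the real inner product from the norms, and replacing
  \<open>q\<close> by \<open>\<i> *\<^sub>C q\<close> recovers the imaginary part. A relation takes
  the place of an operator because \<open>isometric_relation_extends\<close> applies this to the
  closure of a graph.\<close>

lemma isometric_relation_cinner: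
  assumes "\<And>x y. x \<in> L \<Longrightarrow> y \<in> L \<Longrightarrow> x + y \<in> L" "\<And>c x. x \<in> L \<Longrightarrow> c *\<^sub>C x \<in> L"
    and "\<And>p. p \<in> L \<Longrightarrow> norm (fst p) = norm (snd p)"
    and "p \<in> L" "q \<in> L"
  shows "cinner (fst p) (fst q) = cinner (snd p) (snd q)"
proof -
  have re: "inner (fst p) (fst q) = inner (snd p) (snd q)" if "p \<in> L" "q \<in> L" for p q :: "'a \<times> 'b"
  proof -
    have "norm (fst p + fst q) = norm (snd p + snd q)"
      using assms(3)[OF assms(1)[OF that]] by simp
    moreover have "norm (fst p) = norm (snd p)" "norm (fst q) = norm (snd q)"
      using that assms(3) by auto
    ultimately show ?thesis
      by (simp add: dot_norm[of "fst p"] dot_norm[of "snd p"])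
  qed
  have "inner (fst p) (fst (\<i> *\<^sub>C q)) = inner (snd p) (snd (\<i> *\<^sub>C q))"
    using re assms by blast
  then show ?thesis
    using re[OF assms(4,5)] by (simp add: cinner_eq_inner scaleC_prod_def)
qed

section \<open>Complex subspaces and orthogonal projections\<close>

definition csubsp :: "'h::chilbert_space set \<Rightarrow> bool" where
  "csubsp L \<longleftrightarrow> 0 \<in> L \<and> (\<forall>x\<in>L. \<forall>y\<in>L. x + y \<in> L) \<and> (\<forall>c. \<forall>x\<in>L. c *\<^sub>C x \<in> L)"

lemma csubspD:
  assumes "csubsp L"
  shows "0 \<in> L" "x \<in> L \<Longrightarrow> y \<in> L \<Longrightarrow> x + y \<in> L" "x \<in> L \<Longrightarrow> c *\<^sub>C x \<in> L"
    "x \<in> L \<Longrightarrow> y \<in> L \<Longrightarrow> x - y \<in> L" "x \<in> L \<Longrightarrow> - x \<in> L" "x \<in> L \<Longrightarrow> r *\<^sub>R x \<in> L"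
proof -
  show *: "0 \<in> L" "x \<in> L \<Longrightarrow> y \<in> L \<Longrightarrow> x + y \<in> L" "x \<in> L \<Longrightarrow> c *\<^sub>C x \<in> L" for x y c
    using assms by (auto simp: csubsp_def)
  show m: "x \<in> L \<Longrightarrow> - x \<in> L" for x
    using *(3)[of x "-1"] by (simp add: scaleC_minus_one)
  show "x \<in> L \<Longrightarrow> y \<in> L \<Longrightarrow> x - y \<in> L"
    using *(2)[of x "-y"] m by simp
  show "x \<in> L \<Longrightarrow> r *\<^sub>R x \<in> L"
    using *(3)[of x "complex_of_real r"] by (simp add: scaleC_of_real)
qed

definition ocomp :: "'h::chilbert_space set \<Rightarrow> 'h set" where
  "ocomp L = {x. \<forall>z\<in>L. cinner x z = 0}"

lemma csubsp_ocomp: "csubsp (ocomp L)"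
  by (auto simp: csubsp_def ocomp_def cinner_simps)

lemma closed_ocomp: "closed (ocomp L)"
proof -
  have "ocomp L = (\<Inter>z\<in>L. {x. cinner x z = 0})"
    by (auto simp: ocomp_def)
  also have "closed \<dots>"
    by (intro closed_INT ballI closed_Collect_eq continuous_intros continuous_on_id)
  finally show ?thesis .
qed

lemma csubsp_closure:
  assumes "csubsp L"
  shows "csubsp (closure L)"
proof -
  have "c *\<^sub>C x \<in> closure L" if x: "x \<in> closure L" for c x
  proof -
    obtain f where f: "\<And>n. f n \<in> L" "f \<longlonglongrightarrow> x"
      using x closure_sequential by blast
    have "(\<lambda>n. c *\<^sub>C f n) \<longlonglongrightarrow> c *\<^sub>C x"
      using bounded_linear.tendsto[OF bounded_linear_scaleC f(2)] .
    then show ?thesis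
      using f(1) csubspD(3)[OF assms] closure_sequential[of "c *\<^sub>C x" L] by metis
  qed
  moreover have "x + y \<in> closure L" if x: "x \<in> closure L" and y: "y \<in> closure L" for x y
  proof -
    obtain f g where "\<And>n. f n \<in> L" "f \<longlonglongrightarrow> x" "\<And>n. g n \<in> L" "g \<longlonglongrightarrow> y"
      using x y closure_sequential by metis
    then have "(\<lambda>n. f n + g n) \<longlonglongrightarrow> x + y" "\<And>n. f n + g n \<in> L"
      using csubspD(2)[OF assms] by (auto intro: tendsto_add)
    then show ?thesis
      using closure_sequential[of "x + y" L] by metis
  qed
  ultimately show ?thesis
    using csubspD(1)[OF assms] closure_subset[of L] by (auto simp: csubsp_def)
qed

text \<open>A minimizing sequence for the distance to \<open>L\<close> is Cauchy by the parallelogram law.\<close>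

lemma projection_exists:
  assumes L: "csubsp L" and cl: "closed L"
  shows "\<exists>y\<in>L. \<forall>z\<in>L. cinner (x - y) z = 0"
proof -
  define d where "d = infdist x L"
  have ne: "L \<noteq> {}"
    using csubspD(1)[OF L] by auto
  have dle: "d \<le> norm (x - z)" if "z \<in> L" for z
    using infdist_le[OF that, of x] by (simp add: d_def dist_norm)
  have d0: "0 \<le> d"
    by (simp add: d_def infdist_nonneg)
  have "\<exists>y\<in>L. norm (x - y) < d + 1 / Suc n" for n
  proof -
    have "infdist x L < d + 1 / Suc n"
      by (simp add: d_def)
    then show ?thesis
      unfolding infdist_notempty[OF ne]
      by (subst (asm) cINF_less_iff) (use ne in \<open>auto simp: dist_norm intro!: bdd_belowI[where m=0]\<close>)
  qed
  then obtain f where f: "\<And>n. f n \<in> L" "\<And>n. norm (x - f n) < d + 1 / Suc n"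
    by metis
  have lim: "(\<lambda>n. norm (x - f n)) \<longlonglongrightarrow> d"
  proof (rule tendsto_sandwich[where f="\<lambda>_. d" and h="\<lambda>n. d + 1 / Suc n"])
    show "(\<lambda>n. d + 1 / Suc n) \<longlonglongrightarrow> d"
      using tendsto_add[OF tendsto_const[of d] LIMSEQ_inverse_real_of_nat] by (simp add: inverse_eq_divide)
    show "\<forall>\<^sub>F n in sequentially. norm (x - f n) \<le> d + 1 / real (Suc n)"
      by (rule always_eventually) (use f(2) less_imp_le in blast)
  qed (use dle f in auto)
  have par: "(norm (f m - f n))\<^sup>2 \<le> 2 * (norm (x - f m))\<^sup>2 + 2 * (norm (x - f n))\<^sup>2 - 4 * d\<^sup>2" for m n
  proof -
    have "(1/2) *\<^sub>R (f m + f n) \<in> L"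
      by (intro csubspD(2,6)[OF L] f(1))
    then have "d \<le> norm (x - (1/2) *\<^sub>R (f m + f n))"
      by (rule dle)
    then have "d\<^sup>2 \<le> (norm (x - (1/2) *\<^sub>R (f m + f n)))\<^sup>2"
      using d0 by (simp add: power_mono)
    moreover have "(norm (f m - f n))\<^sup>2 = 2 * (norm (x - f m))\<^sup>2 + 2 * (norm (x - f n))\<^sup>2
        - 4 * (norm (x - (1/2) *\<^sub>R (f m + f n)))\<^sup>2"
      by (simp add: power2_norm_eq_inner inner_simps inner_commute algebra_simps)
    ultimately show ?thesis
      by linarith
  qed
  have "Cauchy f"
  proof (rule metric_CauchyI)
    fix e :: real
    assume e: "0 < e"
    have "(\<lambda>n. (norm (x - f n))\<^sup>2) \<longlonglongrightarrow> d\<^sup>2"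
      by (intro tendsto_power lim)
    then have "\<forall>\<^sub>F n in sequentially. (norm (x - f n))\<^sup>2 < d\<^sup>2 + e\<^sup>2 / 4"
      using e by (intro order_tendstoD) auto
    then obtain N where N: "\<And>n. n \<ge> N \<Longrightarrow> (norm (x - f n))\<^sup>2 < d\<^sup>2 + e\<^sup>2 / 4"
      by (auto simp: eventually_sequentially)
    have "dist (f m) (f n) < e" if "m \<ge> N" "n \<ge> N" for m n
    proof -
      have "(norm (f m - f n))\<^sup>2 < e\<^sup>2"
        using par[of m n] N[OF that(1)] N[OF that(2)] by linarith
      then show ?thesis
        using e by (simp add: dist_norm power2_less_imp_less)
    qed
    then show "\<exists>M. \<forall>m\<ge>M. \<forall>n\<ge>M. dist (f m) (f n) < e"
      by blast
  qed
  then obtain y where y: "f \<longlonglongrightarrow> y"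
    using Cauchy_convergent convergent_def by blast
  have yL: "y \<in> L"
    using closed_sequentially[OF cl] f(1) y by blast
  have "(\<lambda>n. norm (x - f n)) \<longlonglongrightarrow> norm (x - y)"
    by (intro tendsto_intros y)
  then have nd: "norm (x - y) = d"
    using lim LIMSEQ_unique by blast
  have re: "inner (x - y) z = 0" if z: "z \<in> L" for z
  proof (rule ccontr)
    assume nz: "inner (x - y) z \<noteq> 0"
    then have z0: "inner z z > 0"
      by auto
    \<comment> \<open>The \<open>t\<close> for which \<open>y + t *\<^sub>R z\<close> is closest to
      \<open>x\<close>: it would beat the minimal distance \<open>d\<close> unless the inner product
      vanishes.\<close>
    define t where "t = inner (x - y) z / inner z z"
    have "y + t *\<^sub>R z \<in> L"
      by (intro csubspD(2,6)[OF L] yL z)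
    then have "d\<^sup>2 \<le> (norm (x - (y + t *\<^sub>R z)))\<^sup>2"
      using dle d0 by (simp add: power_mono)
    also have "\<dots> = (norm (x - y))\<^sup>2 - 2 * t * inner (x - y) z + t * (t * inner z z)"
      by (simp add: power2_norm_eq_inner inner_simps inner_commute algebra_simps)
    also have "\<dots> = d\<^sup>2 - (inner (x - y) z)\<^sup>2 / inner z z"
      using z0 nd by (simp add: t_def power2_eq_square field_simps)
    finally have "(inner (x - y) z)\<^sup>2 / inner z z \<le> 0"
      by linarith
    moreover have "(inner (x - y) z)\<^sup>2 / inner z z > 0"
      using nz z0 by simp
    ultimately show False
      by linarith
  qed
  then have "cinner (x - y) z = 0" if "z \<in> L" for z
    using that csubspD(3)[OF L] by (simp add: cinner_eq_inner zero_complex.code)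
  with yL show ?thesis
    by blast
qed

lemma orth_proj_eqI:
  assumes "csubsp L" "y \<in> L" "\<And>z. z \<in> L \<Longrightarrow> cinner (x - y) z = 0"
  shows "orth_proj L x = y"
  unfolding orth_proj_def
proof (rule the_equality)
  fix w
  assume w: "w \<in> L \<and> (\<forall>z\<in>L. cinner (x - w) z = 0)"
  then have "w - y \<in> L"
    using csubspD(4)[OF assms(1)] assms(2) by blast
  then have "cinner (x - w) (w - y) = 0" "cinner (x - y) (w - y) = 0"
    using w assms by auto
  moreover have "cinner (w - y) (w - y) = cinner (x - y) (w - y) - cinner (x - w) (w - y)"
    by (simp flip: cinner_diff_left)
  ultimately have "cinner (w - y) (w - y) = 0"
    by simp
  then show "w = y"
    by simp
qed (use assms in auto)

lemma
  assumes "csubsp L" "closed L"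
  shows orth_proj_in: "orth_proj L x \<in> L"
    and orth_proj_orth: "z \<in> L \<Longrightarrow> cinner (x - orth_proj L x) z = 0"
    and orth_proj_orth_right: "z \<in> L \<Longrightarrow> cinner z (x - orth_proj L x) = 0"
proof -
  obtain y where "y \<in> L" "\<And>z. z \<in> L \<Longrightarrow> cinner (x - y) z = 0"
    using projection_exists[OF assms] by blast
  then show "orth_proj L x \<in> L" "z \<in> L \<Longrightarrow> cinner (x - orth_proj L x) z = 0"
    "z \<in> L \<Longrightarrow> cinner z (x - orth_proj L x) = 0"
    using orth_proj_eqI[OF assms(1)] cinner_eq_zero_commute by metis+
qed

lemma orth_proj_id: "csubsp L \<Longrightarrow> x \<in> L \<Longrightarrow> orth_proj L x = x"
  by (rule orth_proj_eqI) auto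

lemma orth_proj_zero: "csubsp L \<Longrightarrow> x \<in> ocomp L \<Longrightarrow> orth_proj L x = 0"
  by (rule orth_proj_eqI) (auto simp: ocomp_def csubspD)

lemma orth_proj_diff_ocomp: "csubsp L \<Longrightarrow> closed L \<Longrightarrow> x - orth_proj L x \<in> ocomp L"
  by (simp add: ocomp_def orth_proj_orth)

lemma ocomp_ocomp:
  assumes "csubsp L" "closed L"
  shows "ocomp (ocomp L) = L"
proof
  show "L \<subseteq> ocomp (ocomp L)"
    using cinner_eq_zero_commute by (fastforce simp: ocomp_def)
  show "ocomp (ocomp L) \<subseteq> L"
  proof
    fix x
    assume x: "x \<in> ocomp (ocomp L)"
    have y: "x - orth_proj L x \<in> ocomp L"
      using assms by (rule orth_proj_diff_ocomp)
    then have "cinner x (x - orth_proj L x) = 0"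
      using x by (auto simp: ocomp_def)
    moreover have "cinner (orth_proj L x) (x - orth_proj L x) = 0"
      using assms by (intro orth_proj_orth_right orth_proj_in)
    ultimately have "cinner (x - orth_proj L x) (x - orth_proj L x) = 0"
      by (simp add: cinner_diff_left)
    then have "x = orth_proj L x"
      by simp
    then show "x \<in> L"
      using orth_proj_in[OF assms] by metis
  qed
qed

lemma orth_proj_norm_le:
  assumes "csubsp L" "closed L"
  shows "norm (orth_proj L x) \<le> norm x"
proof -
  let ?y = "orth_proj L x"
  have "cinner (x - ?y) ?y = 0"
    by (rule orth_proj_orth[OF assms orth_proj_in[OF assms]])
  then have "inner (x - ?y) ?y = 0"
    by (simp add: inner_eq_Re_cinner)
  then have "inner ?y ?y = inner x ?y"
    by (simp add: inner_diff_left)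
  also have "\<dots> \<le> norm x * norm ?y"
    by (rule norm_cauchy_schwarz)
  finally have "norm ?y * norm ?y \<le> norm x * norm ?y"
    by (simp add: dot_square_norm power2_eq_square)
  then show ?thesis
    by (metis mult_le_cancel_right norm_ge_zero order.not_eq_order_implies_strict)
qed

lemma orth_proj_add:
  assumes "csubsp L" "closed L"
  shows "orth_proj L (x + y) = orth_proj L x + orth_proj L y"
proof (rule orth_proj_eqI)
  fix z assume "z \<in> L"
  then have "cinner (x - orth_proj L x) z = 0" "cinner (y - orth_proj L y) z = 0"
    using assms by (auto intro: orth_proj_orth)
  then show "cinner (x + y - (orth_proj L x + orth_proj L y)) z = 0"
    by (simp add: cinner_simps)
qed (use assms in \<open>auto intro: csubspD orth_proj_in\<close>)

lemma orth_proj_scaleC: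
  assumes "csubsp L" "closed L"
  shows "orth_proj L (c *\<^sub>C x) = c *\<^sub>C orth_proj L x"
proof (rule orth_proj_eqI)
  fix z assume "z \<in> L"
  then have "cinner (x - orth_proj L x) z = 0"
    using assms by (auto intro: orth_proj_orth)
  then show "cinner (c *\<^sub>C x - c *\<^sub>C orth_proj L x) z = 0"
    by (simp add: cinner_scaleC_left flip: scaleC_diff_right)
qed (use assms in \<open>auto intro: csubspD orth_proj_in\<close>)

lemma orth_proj_bounded_ops: "csubsp L \<Longrightarrow> closed L \<Longrightarrow> orth_proj L \<in> bounded_ops"
  by (rule bounded_opsI[where K=1]) (auto simp: orth_proj_add orth_proj_scaleC orth_proj_norm_le)

lemma orth_proj_selfadj:
  assumes "csubsp L" "closed L"
  shows "cinner (orth_proj L x) y = cinner x (orth_proj L y)"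
proof -
  have "cinner (orth_proj L x) (y - orth_proj L y) = 0" "cinner (x - orth_proj L x) (orth_proj L y) = 0"
    using assms orth_proj_in orth_proj_orth orth_proj_orth_right by metis+
  then show ?thesis
    by (simp add: cinner_simps)
qed

lemma orth_proj_eq_zero_iff:
  assumes "csubsp L" "closed L"
  shows "orth_proj L x = 0 \<longleftrightarrow> x \<in> ocomp L"
  using orth_proj_diff_ocomp[OF assms, of x] orth_proj_zero[OF assms(1)] by auto

section \<open>Riesz representation and adjoints\<close>

lemma riesz:
  fixes f :: "'h::chilbert_space \<Rightarrow> complex"
  assumes f: "bounded_linear f" and fc: "\<And>c x. f (c *\<^sub>C x) = c * f x"
  shows "\<exists>y. \<forall>x. f x = cinner x y"
proof (cases "\<forall>x. f x = 0")
  case True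
  then show ?thesis
    by (intro exI[of _ 0]) simp
next
  case False
  then obtain a where a: "f a \<noteq> 0"
    by blast
  interpret bounded_linear f by fact
  define L where "L = {x. f x = 0}"
  have L: "csubsp L" "closed L"
    by (auto simp: csubsp_def L_def add fc zero intro!: closed_Collect_eq continuous_intros continuous_on)
  \<comment> \<open>\<open>e\<close> is orthogonal to the kernel and spans its complement: every
    \<open>x\<close> differs from \<open>(f x / f e) *\<^sub>C e\<close> by an element of the
    kernel.\<close>
  define e where "e = a - orth_proj L a"
  have fe: "f e = f a"
    using orth_proj_in[OF L, of a] by (simp add: e_def diff L_def)
  then have e0: "cinner e e \<noteq> 0"
    using a zero by auto
  have "f x = cinner x ((cnj (f e) / cnj (cinner e e)) *\<^sub>C e)" for x
  proof -
    have "x - (f x / f e) *\<^sub>C e \<in> L"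
      using a fe by (simp add: L_def diff fc)
    then have "cinner (x - (f x / f e) *\<^sub>C e) e = 0"
      unfolding e_def by (rule orth_proj_orth_right[OF L])
    then have "cinner x e = f x / f e * cinner e e"
      by (simp add: cinner_simps)
    then show ?thesis
      using e0 a fe by (simp add: cinner_scaleC_right field_simps)
  qed
  then show ?thesis
    by blast
qed

lemma adjoint_exists:
  assumes X: "X \<in> bounded_ops"
  shows "\<exists>Y. \<forall>x y. cinner (X x) y = cinner x (Y y)"
proof -
  have "\<exists>z. \<forall>x. cinner (X x) y = cinner x z" for y
    by (rule riesz)
      (auto simp: bounded_opsD[OF X] cinner_simps
        intro!: bounded_linear_compose[OF bounded_linear_cinner_left bounded_opsD(1)[OF X]])
  then show ?thesis
    by metis
qed

lemma cadjoint_unique: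
  assumes "\<And>x y. cinner (X x) y = cinner x (Y y)"
  shows "cadjoint X = Y"
  unfolding cadjoint_def
proof (rule the_equality)
  fix Y'
  assume "\<forall>x y. cinner (X x) y = cinner x (Y' y)"
  then have "cinner x (Y' y) = cinner x (Y y)" for x y
    using assms by metis
  then show "Y' = Y"
    by (intro ext) (rule cinner_ext_right)
qed (use assms in auto)

lemma cadjoint:
  assumes "X \<in> bounded_ops"
  shows "cinner (X x) y = cinner x (cadjoint X y)" "cinner (cadjoint X x) y = cinner x (X y)"
proof -
  show *: "cinner (X x) y = cinner x (cadjoint X y)" for x y
    using adjoint_exists[OF assms] cadjoint_unique[of X] by metis
  show "cinner (cadjoint X x) y = cinner x (X y)"
    by (metis * cinner_commute)
qed

lemma cadjoint_bounded_ops: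
  assumes X: "X \<in> bounded_ops"
  shows "cadjoint X \<in> bounded_ops"
proof -
  obtain K where K: "\<And>x. norm (X x) \<le> norm x * K"
    using bounded_linear.bounded[OF bounded_opsD(1)[OF X]] by blast
  have "norm (cadjoint X x) \<le> norm x * K" for x
  proof -
    let ?y = "cadjoint X x"
    have "(norm ?y)\<^sup>2 = cmod (cinner ?y ?y)"
      by (simp add: cinner_self norm_power)
    also have "\<dots> = cmod (cinner x (X ?y))"
      by (simp add: cadjoint[OF X])
    also have "\<dots> \<le> norm x * norm (X ?y)"
      by (rule cmod_cinner_le)
    also have "\<dots> \<le> norm x * (norm ?y * K)"
      by (intro mult_left_mono K) simp
    finally have "norm ?y * norm ?y \<le> norm ?y * (norm x * K)"
      by (simp only: power2_eq_square mult.left_commute)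
    moreover have "0 \<le> norm x * K"
      using order_trans[OF norm_ge_zero K[of x]] .
    ultimately show ?thesis
      by (cases "?y = 0") (simp_all add: mult_le_cancel_left_pos)
  qed
  moreover have "cadjoint X (x + y) = cadjoint X x + cadjoint X y" for x y
    by (rule cinner_ext) (simp add: cadjoint(2)[OF X] cinner_add_left)
  moreover have "cadjoint X (c *\<^sub>C x) = c *\<^sub>C cadjoint X x" for c x
    by (rule cinner_ext) (simp add: cadjoint(2)[OF X] cinner_scaleC_left)
  ultimately show ?thesis
    by (rule bounded_opsI[rotated 2])
qed

lemma cadjoint_cadjoint: "X \<in> bounded_ops \<Longrightarrow> cadjoint (cadjoint X) = X"
  by (rule cadjoint_unique) (simp add: cadjoint)

lemma cadjoint_comp:
  assumes "X \<in> bounded_ops" "Y \<in> bounded_ops"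
  shows "cadjoint (X \<circ> Y) = cadjoint Y \<circ> cadjoint X"
  by (rule cadjoint_unique) (simp add: cadjoint[OF assms(1)] cadjoint[OF assms(2)])

lemma cadjoint_orth_proj: "csubsp L \<Longrightarrow> closed L \<Longrightarrow> cadjoint (orth_proj L) = orth_proj L"
  by (rule cadjoint_unique) (rule orth_proj_selfadj)

text \<open>Invariance of \<open>L\<close> under the adjoint amounts to invariance of the complement
  of \<open>L\<close> under \<open>X\<close>, so \<open>X\<close> respects the decomposition of
  \<open>x\<close>.\<close>

lemma orth_proj_commute:
  assumes L: "csubsp L" "closed L" and X: "X \<in> bounded_ops"
    and inv: "\<And>x. x \<in> L \<Longrightarrow> X x \<in> L" "\<And>x. x \<in> L \<Longrightarrow> cadjoint X x \<in> L"
  shows "orth_proj L (X x) = X (orth_proj L x)"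
proof (rule orth_proj_eqI[OF L(1)])
  show "X (orth_proj L x) \<in> L"
    by (intro inv orth_proj_in L)
  show "cinner (X x - X (orth_proj L x)) z = 0" if "z \<in> L" for z
    using orth_proj_orth[OF L inv(2)[OF that]]
    by (simp add: cadjoint[OF X] flip: bounded_opsD(3)[OF X])
qed

section \<open>Subspaces affiliated with a von Neumann algebra\<close>


lemma closure_image_mem:
  assumes "X \<in> bounded_ops" "\<And>x. x \<in> L \<Longrightarrow> X x \<in> L'" "x \<in> closure L"
  shows "X x \<in> closure L'"
proof -
  obtain f where f: "\<And>n. f n \<in> L" "f \<longlonglongrightarrow> x"
    using assms(3) closure_sequential by blast
  have "(\<lambda>n. X (f n)) \<longlonglongrightarrow> X x"
    using bounded_linear.tendsto[OF bounded_opsD(1)[OF assms(1)] f(2)] .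
  then show ?thesis
    unfolding closure_sequential using assms(2)[OF f(1)] by (intro exI[of _ "\<lambda>n. X (f n)"]) simp
qed

lemma ocomp_closure: "ocomp (closure L) = ocomp L"
proof
  show "ocomp L \<subseteq> ocomp (closure L)"
  proof
    fix x assume x: "x \<in> ocomp L"
    have "closure L \<subseteq> {z. cinner x z = 0}"
      using x by (intro closure_minimal closed_Collect_eq continuous_intros continuous_on_id)
        (auto simp: ocomp_def)
    then show "x \<in> ocomp (closure L)"
      by (auto simp: ocomp_def)
  qed
  show "ocomp (closure L) \<subseteq> ocomp L"
    using closure_subset by (auto simp: ocomp_def)
qed

lemma continuous_on_bounded_ops:
  "X \<in> bounded_ops \<Longrightarrow> continuous_on S f \<Longrightarrow> continuous_on S (\<lambda>x. X (f x))"
  using bounded_linear.continuous_on bounded_opsD(1) by blast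

lemma csubsp_subspace: "csubsp L \<Longrightarrow> subspace L"
  by (simp add: subspace_def csubspD)

lemma csubsp_image: "X \<in> bounded_ops \<Longrightarrow> csubsp L \<Longrightarrow> csubsp (X ` L)"
  unfolding csubsp_def
proof (intro conjI ballI allI; (elim imageE)?)
  assume X: "X \<in> bounded_ops" and L: "0 \<in> L \<and> (\<forall>x\<in>L. \<forall>y\<in>L. x + y \<in> L) \<and> (\<forall>c. \<forall>x\<in>L. c *\<^sub>C x \<in> L)"
  show "0 \<in> X ` L"
    using bounded_opsD(5)[OF X] L by (auto intro: image_eqI[of _ _ 0])
  show "u + v \<in> X ` L" if "u = X x" "v = X y" "x \<in> L" "y \<in> L" for u v x y
    using that L by (auto simp: bounded_opsD(2)[OF X, symmetric])
  show "c *\<^sub>C u \<in> X ` L" if "u = X x" "x \<in> L" for u c x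
    using that L by (auto simp: bounded_opsD(6)[OF X, symmetric])
qed

lemma closed_image_bounded_below:
  assumes "X \<in> bounded_ops" "csubsp L" "closed L" "0 < e" "\<And>x. x \<in> L \<Longrightarrow> e * norm x \<le> norm (X x)"
  shows "closed (X ` L)"
  using complete_isometric_image[of e L X] assms bounded_opsD(1)[OF assms(1)]
  by (simp add: csubsp_subspace complete_eq_closed)

lemma isometric_on_cinner:
  assumes "X \<in> bounded_ops" "csubsp L" "\<And>x. x \<in> L \<Longrightarrow> norm (X x) = norm x" "x \<in> L" "y \<in> L"
  shows "cinner (X x) (X y) = cinner x y"
proof -
  have "cinner (fst p) (fst q) = cinner (snd p) (snd q)" if "p \<in> (\<lambda>x. (x, X x)) ` L" "q \<in> (\<lambda>x. (x, X x)) ` L" for p q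
  proof (rule isometric_relation_cinner[OF _ _ _ that])
    fix p q c assume "p \<in> (\<lambda>x. (x, X x)) ` L" "q \<in> (\<lambda>x. (x, X x)) ` L"
    then obtain x y where "p = (x, X x)" "q = (y, X y)" "x \<in> L" "y \<in> L"
      by auto
    then show "p + q \<in> (\<lambda>x. (x, X x)) ` L" "c *\<^sub>C p \<in> (\<lambda>x. (x, X x)) ` L" "norm (fst p) = norm (snd p)"
      using csubspD(2,3)[OF assms(2)] assms(3)
      by (auto simp: scaleC_prod_def bounded_opsD(2,6)[OF assms(1), symmetric])
  qed
  from this[of "(x, X x)" "(y, X y)"] show ?thesis
    using assms by simp
qed

lemma norm_add_orth_sq: "cinner x y = 0 \<Longrightarrow> (norm (x + y))\<^sup>2 = (norm x)\<^sup>2 + (norm y)\<^sup>2"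
  by (rule norm_add_Pythagorean) (simp add: orthogonal_def inner_eq_Re_cinner)

lemma norm_cadjoint_le:
  assumes X: "X \<in> bounded_ops" and le: "\<And>x. norm (X x) \<le> norm x"
  shows "norm (cadjoint X x) \<le> norm x"
proof -
  let ?y = "cadjoint X x"
  have "norm ?y * norm ?y = cmod (cinner ?y ?y)"
    by (simp add: cinner_self power2_eq_square norm_mult)
  also have "\<dots> = cmod (cinner x (X ?y))"
    by (simp add: cadjoint(2)[OF X])
  also have "\<dots> \<le> norm x * norm ?y"
    using cmod_cinner_le[of x "X ?y"] mult_left_mono[OF le[of ?y], of "norm x"] by simp
  finally show ?thesis
    by (cases "?y = 0") simp_all
qed

text \<open>For a von Neumann algebra these are exactly the ranges of its projections: the commutant
  is closed under adjoints, so an invariant \<open>L\<close> has a projection commuting with the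
  commutant, which therefore lies in the bicommutant.\<close>

definition affiliated :: "('h::chilbert_space \<Rightarrow> 'h) set \<Rightarrow> 'h set \<Rightarrow> bool" where
  "affiliated A L \<longleftrightarrow> csubsp L \<and> closed L \<and> (\<forall>c\<in>commutant A. \<forall>x\<in>L. c x \<in> L)"

text \<open>Finiteness of the projection onto \<open>L\<close>, phrased without adjoints.\<close>

definition fin :: "('h::chilbert_space \<Rightarrow> 'h) set \<Rightarrow> 'h set \<Rightarrow> bool" where
  "fin A L \<longleftrightarrow> affiliated A L \<and>
     (\<forall>V\<in>A. (\<forall>x\<in>L. V x \<in> L \<and> norm (V x) = norm x) \<longrightarrow> L \<subseteq> V ` L)"

lemma affiliatedD:
  assumes "affiliated A L"
  shows "csubsp L" "closed L" "c \<in> commutant A \<Longrightarrow> x \<in> L \<Longrightarrow> c x \<in> L"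
  using assms by (auto simp: affiliated_def)

locale vna =
  fixes A :: "('h::chilbert_space \<Rightarrow> 'h) set"
  assumes vna: "von_neumann_algebra A"
begin

lemma star: "star_subalgebra A"
  using vna by (simp add: von_neumann_algebra_def)

lemma bounded: "X \<in> A \<Longrightarrow> X \<in> bounded_ops"
  using star by (auto simp: star_subalgebra_def)

lemma id_mem: "id \<in> A"
  and add_mem: "X \<in> A \<Longrightarrow> Y \<in> A \<Longrightarrow> (\<lambda>x. X x + Y x) \<in> A"
  and scaleC_mem: "X \<in> A \<Longrightarrow> (\<lambda>x. c *\<^sub>C X x) \<in> A"
  and comp_mem: "X \<in> A \<Longrightarrow> Y \<in> A \<Longrightarrow> X \<circ> Y \<in> A"
  and cadjoint_mem: "X \<in> A \<Longrightarrow> cadjoint X \<in> A"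
  using star by (auto simp: star_subalgebra_def)

lemma comp_mem': "X \<in> A \<Longrightarrow> Y \<in> A \<Longrightarrow> (\<lambda>x. X (Y x)) \<in> A"
  using comp_mem by (simp add: comp_def)

lemma diff_mem:
  assumes "X \<in> A" "Y \<in> A"
  shows "(\<lambda>x. X x - Y x) \<in> A"
  using add_mem[OF assms(1) scaleC_mem[OF assms(2), of "-1"]] by (simp add: scaleC_minus_one)

lemma ident_mem: "(\<lambda>x. x) \<in> A"
  using id_mem by (simp add: id_def)

lemma zero_mem: "(\<lambda>x. 0) \<in> A"
  using scaleC_mem[OF id_mem, of 0] by simp

lemma commute:
  assumes "c \<in> commutant A" "X \<in> A"
  shows "X (c x) = c (X x)"
  using assms unfolding commutant_def by (auto dest!: bspec[of _ _ X] simp: fun_eq_iff)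

lemma commutant_bounded: "c \<in> commutant A \<Longrightarrow> c \<in> bounded_ops"
  by (simp add: commutant_def)

lemma memI:
  assumes "X \<in> bounded_ops" "\<And>c x. c \<in> commutant A \<Longrightarrow> X (c x) = c (X x)"
  shows "X \<in> A"
proof -
  have "X \<in> commutant (commutant A)"
    using assms by (auto simp: commutant_def[of "commutant A"] fun_eq_iff)
  then show ?thesis
    using vna by (simp add: von_neumann_algebra_def)
qed

lemma cadjoint_commutant:
  assumes c: "c \<in> commutant A"
  shows "cadjoint c \<in> commutant A"
proof -
  have cb: "c \<in> bounded_ops"
    using c by (rule commutant_bounded)
  have "cadjoint c (Y x) = Y (cadjoint c x)" if Y: "Y \<in> A" for Y x
  proof (rule cinner_ext)
    fix z
    have "cinner (cadjoint c (Y x)) z = cinner x (cadjoint Y (c z))"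
      by (simp add: cadjoint[OF cb] cadjoint[OF bounded[OF Y]])
    also have "\<dots> = cinner x (c (cadjoint Y z))"
      by (simp add: commute[OF c cadjoint_mem[OF Y]])
    also have "\<dots> = cinner (Y (cadjoint c x)) z"
      by (simp add: cadjoint[OF cb] cadjoint(1)[OF bounded[OF Y]])
    finally show "cinner (cadjoint c (Y x)) z = cinner (Y (cadjoint c x)) z" .
  qed
  then show ?thesis
    by (auto simp: commutant_def cadjoint_bounded_ops[OF cb])
qed

lemma orth_proj_mem:
  assumes "affiliated A L"
  shows "orth_proj L \<in> A"
  using assms by (intro memI orth_proj_bounded_ops orth_proj_commute)
    (auto simp: affiliated_def commutant_bounded cadjoint_commutant)

lemma affiliated_ker:
  assumes "X \<in> A"
  shows "affiliated A {x. X x = 0}"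
proof -
  note b = bounded[OF assms]
  have "closed {x. X x = 0}"
    by (intro closed_Collect_eq continuous_on_bounded_ops[OF b] continuous_on_id continuous_on_const)
  moreover have "csubsp {x. X x = 0}"
    by (simp add: csubsp_def bounded_opsD[OF b])
  moreover have "X (c x) = 0" if "c \<in> commutant A" "X x = 0" for c x
    using that by (simp add: commute[OF _ assms] bounded_opsD(5)[OF commutant_bounded])
  ultimately show ?thesis
    by (simp add: affiliated_def)
qed

lemma affiliated_ocomp:
  assumes "affiliated A L"
  shows "affiliated A (ocomp L)"
proof -
  have "c x \<in> ocomp L" if c: "c \<in> commutant A" and x: "x \<in> ocomp L" for c x
    using affiliatedD(3)[OF assms cadjoint_commutant[OF c]] x
    by (simp add: ocomp_def cadjoint(1)[OF commutant_bounded[OF c]])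
  then show ?thesis
    by (simp add: affiliated_def csubsp_ocomp closed_ocomp)
qed

lemma affiliated_Int: "affiliated A L \<Longrightarrow> affiliated A M \<Longrightarrow> affiliated A (L \<inter> M)"
  by (auto simp: affiliated_def csubsp_def)

lemma affiliated_closure:
  assumes "csubsp L" "\<And>c x. c \<in> commutant A \<Longrightarrow> x \<in> L \<Longrightarrow> c x \<in> L"
  shows "affiliated A (closure L)"
  unfolding affiliated_def
proof (intro conjI ballI)
  show "c x \<in> closure L" if "c \<in> commutant A" "x \<in> closure L" for c x
    by (rule closure_image_mem[OF commutant_bounded[OF that(1)] assms(2)[OF that(1)] that(2)])
qed (use assms in \<open>auto intro: csubsp_closure\<close>)

lemma projections_affiliated:
  assumes E: "E \<in> projections A"
  shows "affiliated A (range E)" "orth_proj (range E) = E" "x \<in> range E \<longleftrightarrow> E x = x"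
proof -
  have EA: "E \<in> A" and EE: "E (E x) = E x" and ad: "cadjoint E = E" for x
    using E by (auto simp: projections_def fun_eq_iff)
  show r: "x \<in> range E \<longleftrightarrow> E x = x" for x
    using EE by (metis rangeE rangeI)
  have "range E = {x. x - E x = 0}"
    unfolding set_eq_iff r by auto
  then show "affiliated A (range E)"
    using affiliated_ker[OF diff_mem[OF ident_mem EA]] by simp
  then have "csubsp (range E)"
    by (rule affiliatedD)
  then show "orth_proj (range E) = E"
  proof (intro ext orth_proj_eqI)
    fix x z assume "z \<in> range E"
    then have "cinner (x - E x) (E z) = 0"
      using cadjoint[OF bounded[OF EA], of "x - E x" z]
      by (simp add: ad bounded_opsD(3)[OF bounded[OF EA]] EE)
    then show "cinner (x - E x) z = 0"
      using r[of z] \<open>z \<in> range E\<close> by simp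
  qed auto
qed

lemma range_orth_proj: "affiliated A L \<Longrightarrow> range (orth_proj L) = L"
  by (metis affiliatedD(1,2) orth_proj_id orth_proj_in image_subset_iff rangeI subsetI subset_antisym)

lemma orth_proj_projections: "affiliated A L \<Longrightarrow> orth_proj L \<in> projections A"
  by (auto simp: projections_def orth_proj_mem cadjoint_orth_proj affiliatedD fun_eq_iff
    intro!: orth_proj_id orth_proj_in)

text \<open>An isometry \<open>V\<close> of the range of \<open>E\<close> into itself gives the
  partial isometry \<open>V \<circ> E\<close>, with initial projection \<open>E\<close> and the
  image under \<open>V\<close> as range of its final projection. Conversely, the partial isometry of
  an equivalence restricts to an isometry of the range of \<open>E\<close> into the range of
  \<open>F\<close>. Either way, surjectivity of the isometry corresponds to
  \<open>F = E\<close>.\<close>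

lemma finite_projection_iff:
  assumes E: "E \<in> projections A"
  shows "finite_projection A E \<longleftrightarrow> fin A (range E)"
proof -
  let ?L = "range E"
  have EA: "E \<in> A" and EE: "E (E x) = E x" and ad: "cadjoint E = E" for x
    using E by (auto simp: projections_def fun_eq_iff)
  note L = projections_affiliated[OF E]
  show ?thesis
  proof
    assume fE: "finite_projection A E"
    show "fin A ?L"
      unfolding fin_def
    proof (intro conjI ballI impI L)
      fix V assume V: "V \<in> A" and iso: "\<forall>x\<in>?L. V x \<in> ?L \<and> norm (V x) = norm x"
      define W where "W = V \<circ> E"
      have W: "W \<in> A"
        using V EA by (simp add: W_def comp_mem)
      note Wb = bounded[OF W]
      have WW: "cadjoint W \<circ> W = E"
      proof
        fix x
        have "cinner (cadjoint W (W x)) z = cinner (E x) z" for z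
        proof -
          have "cinner (cadjoint W (W x)) z = cinner (V (E x)) (V (E z))"
            unfolding cadjoint(2)[OF Wb] by (simp add: W_def)
          also have "\<dots> = cinner (E x) (E z)"
            using iso by (intro isometric_on_cinner[OF bounded[OF V] affiliatedD(1)[OF L(1)]]) auto
          also have "\<dots> = cinner (E x) z"
            using cadjoint(1)[OF bounded[OF EA], of "E x" z] by (simp add: ad EE)
          finally show ?thesis .
        qed
        then show "(cadjoint W \<circ> W) x = E x"
          by (auto intro: cinner_ext)
      qed
      define F where "F = W \<circ> cadjoint W"
      have WE: "W (E x) = W x" for x
        by (simp add: W_def EE)
      have "F \<in> projections A"
      proof -
        have "F \<circ> F = F"
          using WW WE by (auto simp: F_def fun_eq_iff)
        moreover have "cadjoint F = F"
          by (simp add: F_def cadjoint_comp cadjoint_bounded_ops cadjoint_cadjoint Wb)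
        ultimately show ?thesis
          using W by (simp add: projections_def F_def comp_mem cadjoint_mem)
      qed
      moreover have "range F \<subseteq> range E"
        using iso by (auto simp: F_def W_def)
      moreover have "mvn_equiv A E F"
        using W WW by (auto simp: mvn_equiv_def F_def)
      ultimately have "F = E"
        using fE by (auto simp: finite_projection_def)
      then show "?L \<subseteq> V ` ?L"
        by (auto simp: F_def W_def fun_eq_iff image_iff) metis
    qed
  next
    assume fL: "fin A ?L"
    show "finite_projection A E"
      unfolding finite_projection_def
    proof (intro conjI E notI, elim bexE conjE)
      fix F assume F: "F \<in> projections A" "range F \<subseteq> ?L" "F \<noteq> E" "mvn_equiv A E F"
      then obtain V where V: "V \<in> A" "\<And>x. cadjoint V (V x) = E x" "\<And>x. V (cadjoint V x) = F x"
        by (auto simp: mvn_equiv_def fun_eq_iff)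
      have *: "V x = F (V x) \<and> norm (V x) = norm x" if "x \<in> ?L" for x
      proof -
        have Ex: "E x = x"
          using that L(3) by simp
        have "cinner (V x) (V x) = cinner x x"
          using cadjoint(2)[OF bounded[OF V(1)], of "V x" x] by (simp add: V Ex)
        then have "norm (V x) = norm x"
          unfolding cinner_self of_real_eq_iff by (simp add: power2_eq_iff_nonneg)
        moreover have "F (V x) = V x"
          by (metis Ex V(2,3))
        ultimately show ?thesis
          by simp
      qed
      then have "?L \<subseteq> V ` ?L"
        using fL V(1) F(2) unfolding fin_def by (metis rangeI subset_iff)
      also have "\<dots> \<subseteq> range F"
        using * by auto
      finally have "range F = ?L"
        using F(2) by simp
      then show False
        using projections_affiliated(2)[OF F(1)] L(2) F(3) by simp
    qed
  qed
qed

lemma finite_projection_orth_proj: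
  "affiliated A L \<Longrightarrow> finite_projection A (orth_proj L) \<longleftrightarrow> fin A L"
  using finite_projection_iff[OF orth_proj_projections] range_orth_proj by simp

text \<open>If \<open>G\<close> is the graph of a partial isometry \<open>U\<close> with initial projection \<open>D\<close>, then
  \<open>(x, 0)\<close> projects onto half of \<open>(D x, U x)\<close> in the closure of \<open>G\<close>.\<close>

lemma isometric_relation_extends:
  assumes G: "csubsp G" and iso: "\<And>x y. (x, y) \<in> G \<Longrightarrow> norm x = norm y"
    and inv: "\<And>c x y. c \<in> commutant A \<Longrightarrow> (x, y) \<in> G \<Longrightarrow> (c x, c y) \<in> G"
  shows "\<exists>U\<in>A. \<forall>(x, y)\<in>G. U x = y"
proof -
  let ?G = "closure G"
  have cG: "csubsp ?G" "closed ?G"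
    using G by (auto intro: csubsp_closure)
  have "?G \<subseteq> {p. norm (fst p) = norm (snd p)}"
    using iso by (intro closure_minimal closed_Collect_eq continuous_intros continuous_on_id) auto
  then have ic: "cinner (fst p) (fst q) = cinner (snd p) (snd q)" if "p \<in> ?G" "q \<in> ?G" for p q
    using that csubspD(2,3)[OF cG(1)] by (intro isometric_relation_cinner[of ?G]) auto
  define U where "U x = 2 *\<^sub>C snd (orth_proj ?G (x, 0))" for x :: 'h
  have "U x = y" if "(x, y) \<in> G" for x y
  proof -
    have "orth_proj ?G (x, 0) = (1/2) *\<^sub>C (x, y)"
    proof (rule orth_proj_eqI[OF cG(1)])
      have xy: "(x, y) \<in> ?G"
        using that closure_subset by blast
      then show "(1/2) *\<^sub>C (x, y) \<in> ?G"
        by (rule csubspD[OF cG(1)])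
      show "cinner ((x, 0) - (1/2) *\<^sub>C (x, y)) z = 0" if "z \<in> ?G" for z
        using ic[OF xy that] by (simp add: cinner_simps cinner_prod_def scaleC_prod_def)
    qed
    then show ?thesis
      by (simp add: U_def scaleC_prod_def scaleC_scaleC)
  qed
  moreover have "U \<in> A"
  proof (rule memI)
    show "U \<in> bounded_ops"
    proof (rule bounded_opsI)
      show "U (x + y) = U x + U y" for x y
        using orth_proj_add[OF cG, of "(x, 0)" "(y, 0)"] by (simp add: U_def scaleC_add_right)
      show "U (c *\<^sub>C x) = c *\<^sub>C U x" for c x
        using orth_proj_scaleC[OF cG, of c "(x, 0)"]
        by (simp add: U_def scaleC_prod_def scaleC_scaleC mult.commute)
      have "norm (snd (orth_proj ?G (x, 0))) \<le> norm x" for x :: 'h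
        using orth_proj_norm_le[OF cG, of "(x, 0)"] norm_snd_le[of "snd (orth_proj ?G (x, 0))" "fst (orth_proj ?G (x, 0))"]
        by (simp add: norm_Pair)
      then show "norm (U x) \<le> norm x * 2" for x
        by (simp add: U_def norm_scaleC)
    qed
    fix c x assume c: "c \<in> commutant A"
    note cb = commutant_bounded[OF c]
    \<comment> \<open>The diagonal action of \<open>c\<close> on pairs. The closure of
      \<open>G\<close> is invariant under it and under its adjoint, so the projection onto this
      closure commutes with it; reading off second coordinates, \<open>U\<close> commutes with
      \<open>c\<close>.\<close>
    define c2 where "c2 p = (c (fst p), c (snd p))" for p
    have "bounded_linear c2"
      unfolding c2_def using bounded_opsD(1)[OF cb]
      by (intro bounded_linear_Pair) (auto intro: bounded_linear_compose bounded_linear_fst bounded_linear_snd)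
    then have c2b: "c2 \<in> bounded_ops"
      by (simp add: bounded_ops_def c2_def scaleC_prod_def bounded_opsD(6)[OF cb])
    have ad: "cadjoint c2 = (\<lambda>p. (cadjoint c (fst p), cadjoint c (snd p)))"
      by (rule cadjoint_unique) (simp add: c2_def cinner_prod_def cadjoint(1)[OF cb])
    have adb: "cadjoint c2 \<in> bounded_ops"
      by (rule cadjoint_bounded_ops[OF c2b])
    have i1: "c2 p \<in> ?G" if "p \<in> ?G" for p
      using c inv by (intro closure_image_mem[OF c2b _ that]) (auto simp: c2_def)
    have i2: "cadjoint c2 p \<in> ?G" if "p \<in> ?G" for p
      using cadjoint_commutant[OF c] inv by (intro closure_image_mem[OF adb _ that]) (auto simp: ad)
    have "orth_proj ?G (c2 (x, 0)) = c2 (orth_proj ?G (x, 0))"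
      by (rule orth_proj_commute[OF cG c2b i1 i2])
    then show "U (c x) = c (U x)"
      by (simp add: U_def c2_def bounded_opsD[OF cb])
  qed
  ultimately show ?thesis
    by blast
qed

end

section \<open>Polar decomposition\<close>


text \<open>\<open>nonneg_combination D Q a\<close> says that \<open>Q = p D\<close> and \<open>a = p 1\<close> for a polynomial \<open>p\<close> with
  nonnegative coefficients and without constant term.\<close>

inductive nonneg_combination :: "('h::chilbert_space \<Rightarrow> 'h) \<Rightarrow> ('h \<Rightarrow> 'h) \<Rightarrow> real \<Rightarrow> bool" for D where
  zero: "nonneg_combination D (\<lambda>_. 0) 0"
| base: "nonneg_combination D D 1"
| add: "nonneg_combination D Q a \<Longrightarrow> nonneg_combination D R b \<Longrightarrow> nonneg_combination D (\<lambda>x. Q x + R x) (a + b)"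
| mult: "nonneg_combination D Q a \<Longrightarrow> nonneg_combination D R b \<Longrightarrow> nonneg_combination D (\<lambda>x. Q (R x)) (a * b)"
| half: "nonneg_combination D Q a \<Longrightarrow> nonneg_combination D (\<lambda>x. (1/2) *\<^sub>C Q x) (a / 2)"

lemma nonneg_combination_nonneg: "nonneg_combination D Q a \<Longrightarrow> 0 \<le> a"
  by (induction rule: nonneg_combination.induct) auto

lemma nonneg_combination_norm:
  assumes "\<And>x. norm (D x) \<le> norm x"
  shows "nonneg_combination D Q a \<Longrightarrow> norm (Q x) \<le> a * norm x"
proof (induction arbitrary: x rule: nonneg_combination.induct)
  case (add Q a R b)
  show ?case
    using norm_triangle_ineq[of "Q x" "R x"] add.IH[of x] by (simp add: distrib_right)
next
  case (mult Q a R b)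
  have "norm (Q (R x)) \<le> a * norm (R x)"
    by (rule mult.IH)
  also have "\<dots> \<le> a * (b * norm x)"
    using nonneg_combination_nonneg[OF mult.hyps(1)] mult.IH by (intro mult_left_mono) auto
  finally show ?case
    by (simp add: mult.assoc)
next
  case (half Q a)
  then show ?case
    by (simp add: norm_scaleC)
qed (use assms in auto)

lemma nonneg_combination_commute:
  assumes Z: "Z \<in> bounded_ops" and "\<And>x. D (Z x) = Z (D x)"
  shows "nonneg_combination D Q a \<Longrightarrow> Q (Z x) = Z (Q x)"
  by (induction arbitrary: x rule: nonneg_combination.induct) (simp_all add: assms(2) bounded_opsD[OF Z])

text \<open>The classical iteration for \<open>1 - sqrt (1 - D)\<close>. It starts at 0, so every
  iterate is a polynomial in \<open>D\<close> with nonnegative coefficients and without constant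
  term.\<close>

fun sqrt_iter :: "('h::chilbert_space \<Rightarrow> 'h) \<Rightarrow> nat \<Rightarrow> 'h \<Rightarrow> 'h" where
  "sqrt_iter D 0 = (\<lambda>_. 0)"
| "sqrt_iter D (Suc n) = (\<lambda>x. (1/2) *\<^sub>C (D x + sqrt_iter D n (sqrt_iter D n x)))"

text \<open>The same iteration at \<open>D = 1\<close>, that is, the sum of the coefficients of the
  polynomial behind \<open>sqrt_iter\<close>. For a contraction \<open>D\<close> this scalar
  sequence controls the operators, and it is increasing and bounded by 1.\<close>

fun sqrt_bound :: "nat \<Rightarrow> real" where
  "sqrt_bound 0 = 0"
| "sqrt_bound (Suc n) = (1 + sqrt_bound n * sqrt_bound n) / 2"

lemma sqrt_bound_range: "0 \<le> sqrt_bound n \<and> sqrt_bound n \<le> 1"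
  by (induction n) (auto simp: mult_le_one)

lemma nonneg_combination_sqrt_iter: "nonneg_combination D (sqrt_iter D n) (sqrt_bound n)"
proof (induction n)
  case (Suc n)
  show ?case
    unfolding sqrt_iter.simps sqrt_bound.simps
    by (rule nonneg_combination.half[OF nonneg_combination.add[OF nonneg_combination.base
      nonneg_combination.mult[OF Suc Suc]]])
qed (simp add: nonneg_combination.zero)

context vna
begin

lemma nonneg_combination_mem: "D \<in> A \<Longrightarrow> nonneg_combination D Q a \<Longrightarrow> Q \<in> A"
  by (rotate_tac, induction rule: nonneg_combination.induct)
    (auto intro: zero_mem add_mem comp_mem' scaleC_mem)

lemma nonneg_combinations_commute:
  assumes "D \<in> A" "nonneg_combination D Q a" "nonneg_combination D R b"
  shows "Q (R x) = R (Q x)"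
proof -
  have "D (R x) = R (D x)" for x
    using nonneg_combination_commute[OF bounded[OF assms(1)] refl assms(3)] by simp
  then show ?thesis
    using nonneg_combination_commute[OF bounded[OF nonneg_combination_mem[OF assms(1,3)]] _ assms(2)] by simp
qed

lemma nonneg_combination_selfadj:
  assumes "D \<in> A" "\<And>x y. cinner (D x) y = cinner x (D y)"
  shows "nonneg_combination D Q a \<Longrightarrow> cinner (Q x) y = cinner x (Q y)"
proof (induction arbitrary: x y rule: nonneg_combination.induct)
  case (mult Q a R b)
  show ?case
    unfolding mult.IH nonneg_combinations_commute[OF assms(1) mult.hyps, symmetric] ..
qed (simp_all add: assms cinner_simps)

text \<open>The iterates commute, so half the difference of two squares factors as half of sum times
  difference. Nonnegativity of the coefficients thus passes from one difference to the next. The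
  coefficient sum is the exact increment of \<open>sqrt_bound\<close>, which lets the norm estimates
  telescope.\<close>

lemma nonneg_combination_sqrt_iter_diff:
  assumes "D \<in> A"
  shows "nonneg_combination D (\<lambda>x. sqrt_iter D (Suc n) x - sqrt_iter D n x) (sqrt_bound (Suc n) - sqrt_bound n)"
proof (induction n)
  case 0
  show ?case
    using nonneg_combination.half[OF nonneg_combination.base, of D] by simp
next
  case (Suc n)
  let ?R = "sqrt_iter D (Suc n)" and ?S = "sqrt_iter D n"
  let ?a = "sqrt_bound (Suc n)" and ?b = "sqrt_bound n"
  note R = nonneg_combination_sqrt_iter[of D "Suc n"] and S = nonneg_combination_sqrt_iter[of D n]
  have "nonneg_combination D (\<lambda>x. (1/2) *\<^sub>C (?R (?R x - ?S x) + ?S (?R x - ?S x)))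
      ((?a + ?b) * (?a - ?b) / 2)"
    by (rule nonneg_combination.half[OF nonneg_combination.mult[OF nonneg_combination.add[OF R S] Suc]])
  moreover have "(1/2) *\<^sub>C (?R (?R x - ?S x) + ?S (?R x - ?S x))
      = sqrt_iter D (Suc (Suc n)) x - sqrt_iter D (Suc n) x" for x
  proof -
    have "?R (?R x - ?S x) + ?S (?R x - ?S x) = ?R (?R x) - ?S (?S x)"
      using nonneg_combinations_commute[OF assms R S, of x]
      by (simp only: bounded_opsD(3)[OF bounded[OF nonneg_combination_mem[OF assms R]]]
          bounded_opsD(3)[OF bounded[OF nonneg_combination_mem[OF assms S]]]) simp
    moreover have "sqrt_iter D (Suc (Suc n)) x - sqrt_iter D (Suc n) x = (1/2) *\<^sub>C (?R (?R x) - ?S (?S x))"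
      unfolding sqrt_iter.simps(2)[of D "Suc n"]
      by (subst (3) sqrt_iter.simps(2)) (simp only: scaleC_diff_right[symmetric] add_diff_cancel_left)
    ultimately show ?thesis
      by simp
  qed
  moreover have "(a + b) * (a - b) / 2 = (1 + a * a) / 2 - a" if "a = (1 + b * b) / 2" for a b :: real
    using that by (simp add: field_simps)
  then have "(?a + ?b) * (?a - ?b) / 2 = sqrt_bound (Suc (Suc n)) - sqrt_bound (Suc n)"
    using sqrt_bound.simps(2)[of n] sqrt_bound.simps(2)[of "Suc n"] by metis
  ultimately show ?case
    by (simp only:)
qed

lemma sqrt_iter_diff_norm:
  assumes "D \<in> A" "\<And>x. norm (D x) \<le> norm x" "n \<le> m"
  shows "norm (sqrt_iter D m x - sqrt_iter D n x) \<le> (sqrt_bound m - sqrt_bound n) * norm x"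
  using \<open>n \<le> m\<close>
proof (induction m rule: dec_induct)
  case (step m)
  have "norm (sqrt_iter D (Suc m) x - sqrt_iter D m x) \<le> (sqrt_bound (Suc m) - sqrt_bound m) * norm x"
    by (rule nonneg_combination_norm[OF assms(2) nonneg_combination_sqrt_iter_diff[OF assms(1)]])
  then show ?case
    using step.IH norm_triangle_ineq[of "sqrt_iter D (Suc m) x - sqrt_iter D m x" "sqrt_iter D m x - sqrt_iter D n x"]
    by (simp add: algebra_simps del: sqrt_iter.simps sqrt_bound.simps)
qed simp

lemma sqrt_iter_convergent:
  assumes "D \<in> A" "\<And>x. norm (D x) \<le> norm x"
  shows "convergent (\<lambda>n. sqrt_iter D n x)"
proof -
  have "sqrt_bound n \<le> sqrt_bound (Suc n)" for n
    using nonneg_combination_nonneg[OF nonneg_combination_sqrt_iter_diff[OF assms(1)], of n] by simp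
  then have mono: "incseq sqrt_bound"
    by (rule incseq_SucI)
  then have "convergent sqrt_bound"
    using sqrt_bound_range by (metis convergentI incseq_convergent)
  then have "convergent (\<lambda>n. sqrt_bound n * norm x)"
    by (intro convergent_mult convergent_const)
  then have cau: "Cauchy (\<lambda>n. sqrt_bound n * norm x)"
    by (rule convergent_Cauchy)
  have "Cauchy (\<lambda>n. sqrt_iter D n x)"
  proof (rule metric_CauchyI)
    fix e :: real assume "0 < e"
    then obtain M where M: "\<And>m n. m \<ge> M \<Longrightarrow> n \<ge> M \<Longrightarrow> dist (sqrt_bound m * norm x) (sqrt_bound n * norm x) < e"
      using metric_CauchyD[OF cau] by blast
    have *: "dist (sqrt_iter D m x) (sqrt_iter D n x) < e" if "m \<ge> n" "n \<ge> M" for m n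
      using sqrt_iter_diff_norm[OF assms that(1), of x] M[of m n] that
      by (simp add: dist_norm left_diff_distrib)
    have "dist (sqrt_iter D m x) (sqrt_iter D n x) < e" if "m \<ge> M" "n \<ge> M" for m n
      using *[of m n] *[of n m] that by (cases "n \<le> m") (auto simp: dist_commute)
    then show "\<exists>M. \<forall>m\<ge>M. \<forall>n\<ge>M. dist (sqrt_iter D m x) (sqrt_iter D n x) < e"
      by blast
  qed
  then show ?thesis
    by (rule Cauchy_convergent)
qed

text \<open>The limit \<open>R\<close> of the iteration satisfies \<open>R = (D + R\<^sup>2) / 2\<close>, that is, \<open>(1 - R)\<^sup>2 = 1 - D\<close>.\<close>

lemma selfadjoint_sqrt:
  assumes D: "D \<in> A" and le: "\<And>x. norm (D x) \<le> norm x"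
    and sa: "\<And>x y. cinner (D x) y = cinner x (D y)"
  shows "\<exists>Y\<in>A. (\<forall>x y. cinner (Y x) y = cinner x (Y y)) \<and> (\<forall>x. Y (Y x) = x - D x)"
proof -
  define R where "R x = lim (\<lambda>n. sqrt_iter D n x)" for x
  have lim: "(\<lambda>n. sqrt_iter D n x) \<longlonglongrightarrow> R x" for x
    unfolding R_def using sqrt_iter_convergent[OF D le] convergent_LIMSEQ_iff by blast
  note nc = nonneg_combination_sqrt_iter[of D]
  have mem: "sqrt_iter D n \<in> A" for n
    by (rule nonneg_combination_mem[OF D nc])
  note bd = bounded[OF mem]
  have contr: "norm (sqrt_iter D n x) \<le> norm x" for n x
    using nonneg_combination_norm[OF le nc, of n x] sqrt_bound_range[of n]
      mult_right_mono[of "sqrt_bound n" 1 "norm x"] by simp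
  have Rb: "R \<in> bounded_ops"
  proof (rule bounded_opsI)
    show "R (x + y) = R x + R y" for x y
      using tendsto_add[OF lim[of x] lim[of y]] lim[of "x + y"]
      by (auto simp: bounded_opsD(2)[OF bd] intro: LIMSEQ_unique)
    show "R (c *\<^sub>C x) = c *\<^sub>C R x" for c x
      using bounded_linear.tendsto[OF bounded_linear_scaleC lim[of x], of c] lim[of "c *\<^sub>C x"]
      by (auto simp: bounded_opsD(6)[OF bd] intro: LIMSEQ_unique)
    show "norm (R x) \<le> norm x * 1" for x
      using tendsto_norm[OF lim[of x]] contr by (auto intro: LIMSEQ_le_const2)
  qed
  have RA: "R \<in> A"
  proof (rule memI[OF Rb])
    fix c x assume c: "c \<in> commutant A"
    show "R (c x) = c (R x)"
      using bounded_linear.tendsto[OF bounded_opsD(1)[OF commutant_bounded[OF c]] lim[of x]] lim[of "c x"]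
      by (auto simp: commute[OF c mem] intro: LIMSEQ_unique)
  qed
  have Rsa: "cinner (R x) y = cinner x (R y)" for x y
    using bounded_linear.tendsto[OF bounded_linear_cinner_left lim[of x], of y]
      bounded_linear.tendsto[OF bounded_linear_cinner_right lim[of y], of x]
    by (auto simp: nonneg_combination_selfadj[OF D sa nc] intro: LIMSEQ_unique)
  have RR: "(\<lambda>n. sqrt_iter D n (sqrt_iter D n x)) \<longlonglongrightarrow> R (R x)" for x
  proof -
    \<comment> \<open>Pointwise convergence does not by itself pass to products of operators; here
      it does because all iterates are contractions.\<close>
    have "(\<lambda>n. sqrt_iter D n (sqrt_iter D n x - R x)) \<longlonglongrightarrow> 0"
    proof (rule tendsto_0_le[where K=1])
      show "(\<lambda>n. sqrt_iter D n x - R x) \<longlonglongrightarrow> 0"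
        using lim[of x] by (simp add: LIM_zero)
    qed (simp add: contr)
    then have "(\<lambda>n. sqrt_iter D n (sqrt_iter D n x - R x) + sqrt_iter D n (R x)) \<longlonglongrightarrow> 0 + R (R x)"
      by (intro tendsto_add lim)
    then show ?thesis
      by (simp add: bounded_opsD(3)[OF bd])
  qed
  have fix_eq: "R x = (1/2) *\<^sub>C (D x + R (R x))" for x
  proof -
    have "(\<lambda>n. sqrt_iter D (Suc n) x) \<longlonglongrightarrow> (1/2) *\<^sub>C (D x + R (R x))"
      unfolding sqrt_iter.simps
      by (intro bounded_linear.tendsto[OF bounded_linear_scaleC] tendsto_intros RR)
    then show ?thesis
      using LIMSEQ_Suc[OF lim[of x]] LIMSEQ_unique by blast
  qed
  have "(x - R x) - R (x - R x) = x - D x" for x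
  proof -
    have "R x + R x = 2 *\<^sub>C R x"
      using scaleC_add_left[of 1 1 "R x"] by simp
    also have "\<dots> = D x + R (R x)"
      by (subst fix_eq) (simp add: scaleC_scaleC)
    finally show ?thesis
      by (simp add: bounded_opsD(3)[OF Rb] algebra_simps)
  qed
  then show ?thesis
    using Rsa by (intro bexI[of _ "\<lambda>x. x - R x"] diff_mem ident_mem RA) (auto simp: cinner_simps)
qed

text \<open>\<open>Y\<close> is a self-adjoint square root of \<open>1 - D\<close>, where
  \<open>D\<close> is 1 minus the adjoint of \<open>X\<close> times \<open>X\<close>. As
  \<open>X\<close> is a contraction, expanding the square of \<open>norm (D x)\<close> gives at most
  the square of \<open>norm x\<close> minus that of \<open>norm (X x)\<close>, so \<open>D\<close>
  is a contraction as \<open>selfadjoint_sqrt\<close> requires.\<close>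

lemma absolute_value_exists:
  assumes X: "X \<in> A" and le: "\<And>x. norm (X x) \<le> norm x"
  shows "\<exists>Y\<in>A. (\<forall>x y. cinner (Y x) y = cinner x (Y y)) \<and> (\<forall>x. norm (Y x) = norm (X x))"
proof -
  define D where "D x = x - cadjoint X (X x)" for x
  note Xb = bounded[OF X]
  have D: "D \<in> A"
    unfolding D_def by (rule diff_mem[OF ident_mem comp_mem'[OF cadjoint_mem[OF X] X]])
  have sa: "cinner (D x) y = cinner x (D y)" for x y
    by (simp add: D_def cinner_diff_left cinner_diff_right cadjoint(2)[OF Xb] flip: cadjoint(1)[OF Xb])
  have Dle: "norm (D x) \<le> norm x" for x
  proof -
    have "inner x (cadjoint X (X x)) = (norm (X x))\<^sup>2"
      using cadjoint(1)[OF Xb, of x "X x"]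
      by (metis Re_complex_of_real cinner_self inner_eq_Re_cinner)
    then have "(norm (D x))\<^sup>2 = (norm x)\<^sup>2 - 2 * (norm (X x))\<^sup>2 + (norm (cadjoint X (X x)))\<^sup>2"
      by (simp add: D_def power2_norm_eq_inner inner_simps inner_commute)
    moreover have "(norm (cadjoint X (X x)))\<^sup>2 \<le> (norm (X x))\<^sup>2"
      using norm_cadjoint_le[OF Xb le] by (simp add: power_mono)
    ultimately have "(norm (D x))\<^sup>2 \<le> (norm x)\<^sup>2"
      using zero_le_power2[of "norm (X x)"] by linarith
    then show ?thesis
      by (simp add: power2_le_iff_abs_le)
  qed
  obtain Y where Y: "Y \<in> A" "\<And>x y. cinner (Y x) y = cinner x (Y y)" "\<And>x. Y (Y x) = cadjoint X (X x)"
    using selfadjoint_sqrt[OF D Dle sa] by (auto simp: D_def)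
  have "norm (Y x) = norm (X x)" for x
  proof -
    have "cinner (Y x) (Y x) = cinner (X x) (X x)"
      by (simp add: Y(2,3) cadjoint(1)[OF Xb])
    then show ?thesis
      unfolding cinner_self of_real_eq_iff by (simp add: power2_eq_iff_nonneg)
  qed
  with Y show ?thesis
    by blast
qed

text \<open>The partial isometry of the polar decomposition of \<open>X\<close> restricted to \<open>L\<close>, provided by the
  isometric relation \<open>|X| x \<mapsto> X x\<close>.\<close>

lemma injective_imp_isometric:
  assumes X: "X \<in> A" and L: "affiliated A L" and L': "closed L'" "csubsp L'"
    and into: "\<And>x. x \<in> L \<Longrightarrow> X x \<in> L'" and inj: "\<And>x. x \<in> L \<Longrightarrow> X x = 0 \<Longrightarrow> x = 0"
  shows "\<exists>U\<in>A. \<forall>x\<in>L. U x \<in> L' \<and> norm (U x) = norm x"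
proof -
  note cL = affiliatedD(1,2)[OF L]
  have XP: "(\<lambda>x. X (orth_proj L x)) \<in> A"
    by (rule comp_mem'[OF X orth_proj_mem[OF L]])
  obtain K where K: "K > 0" "\<And>x. norm (X (orth_proj L x)) \<le> norm x * K"
    using bounded_linear.pos_bounded[OF bounded_opsD(1)[OF bounded[OF XP]]] by blast
  \<comment> \<open>Cut down to \<open>L\<close> and divided by a norm bound, so that
    \<open>absolute_value_exists\<close> applies. By injectivity on \<open>L\<close>, the kernel of
    \<open>Z\<close> is the complement of \<open>L\<close>.\<close>
  define Z where "Z x = (1 / complex_of_real K) *\<^sub>C X (orth_proj L x)" for x
  have Z: "Z \<in> A"
    unfolding Z_def by (rule scaleC_mem[OF XP])
  note Zb = bounded[OF Z]
  have Zle: "norm (Z x) \<le> norm x" for x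
    using K by (simp add: Z_def norm_scaleC norm_divide field_simps)
  have ZL': "Z x \<in> L'" for x
    unfolding Z_def by (intro csubspD(3)[OF L'(2)] into orth_proj_in[OF cL])
  have Z0: "orth_proj L x = 0" if "Z x = 0" for x
  proof -
    have "complex_of_real K *\<^sub>C Z x = X (orth_proj L x)"
      using K by (simp add: Z_def scaleC_scaleC)
    then show ?thesis
      using that inj orth_proj_in[OF cL] by simp
  qed
  obtain Y where Y: "Y \<in> A" "\<And>x y. cinner (Y x) y = cinner x (Y y)" "\<And>x. norm (Y x) = norm (Z x)"
    using absolute_value_exists[OF Z Zle] by auto
  note Yb = bounded[OF Y(1)]
  have "\<exists>U\<in>A. \<forall>(x, y)\<in>range (\<lambda>x. (Y x, Z x)). U x = y"
  proof (rule isometric_relation_extends)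
    show "csubsp (range (\<lambda>x. (Y x, Z x)))"
      unfolding csubsp_def
    proof (intro conjI ballI allI; (elim rangeE)?)
      show "0 \<in> range (\<lambda>x. (Y x, Z x))"
        by (rule range_eqI[of _ _ 0]) (simp add: zero_prod_def bounded_opsD(5)[OF Yb] bounded_opsD(5)[OF Zb])
      show "p + q \<in> range (\<lambda>x. (Y x, Z x))" if "p = (Y x, Z x)" "q = (Y y, Z y)" for p q x y
        by (rule range_eqI[of _ _ "x + y"]) (simp add: that bounded_opsD(2)[OF Yb] bounded_opsD(2)[OF Zb])
      show "c *\<^sub>C p \<in> range (\<lambda>x. (Y x, Z x))" if "p = (Y x, Z x)" for p c x
        by (rule range_eqI[of _ _ "c *\<^sub>C x"])
          (simp add: that scaleC_prod_def bounded_opsD(6)[OF Yb] bounded_opsD(6)[OF Zb])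
    qed
    show "(c x, c y) \<in> range (\<lambda>x. (Y x, Z x))"
      if "c \<in> commutant A" "(x, y) \<in> range (\<lambda>x. (Y x, Z x))" for c x y
      using that by (auto simp: commute[OF that(1) Y(1), symmetric] commute[OF that(1) Z, symmetric])
  qed (auto simp: Y(3))
  then obtain U where U: "U \<in> A" "\<And>x. U (Y x) = Z x"
    by auto
  note Ub = bounded[OF U(1)]
  have rY: "csubsp (range Y)"
    using csubsp_image[OF Yb, of UNIV] by (simp add: csubsp_def)
  have "closure (range Y) \<subseteq> {x. U x \<in> L' \<and> norm (U x) = norm x}"
  proof (rule closure_minimal)
    have "closed (U -` L' \<inter> {x. norm (U x) = norm x})"
      by (intro closed_Int closed_vimage closed_Collect_eq continuous_intros L'
          continuous_on_bounded_ops[OF Ub] continuous_on_id)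
    then show "closed {x. U x \<in> L' \<and> norm (U x) = norm x}"
      by (simp add: vimage_def Collect_conj_eq)
  qed (auto simp: U ZL' Y(3))
  \<comment> \<open>A vector orthogonal to the range of the self-adjoint \<open>Y\<close> is killed
    by \<open>Y\<close>, hence by \<open>Z\<close>, hence is orthogonal to \<open>L\<close>. For the
    part \<open>w\<close> of \<open>x\<close> outside the closure this forces
    \<open>w = 0\<close>.\<close>
  moreover have "L \<subseteq> closure (range Y)"
  proof
    fix x assume x: "x \<in> L"
    let ?C = "closure (range Y)"
    have C: "csubsp ?C" "closed ?C"
      using rY by (auto intro: csubsp_closure)
    define w where "w = x - orth_proj ?C x"
    have "w \<in> ocomp (range Y)"
      using orth_proj_diff_ocomp[OF C] by (simp add: w_def ocomp_closure)
    then have "cinner (Y w) (Y w) = 0"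
      unfolding Y(2) by (auto simp: ocomp_def)
    then have "Z w = 0"
      using Y(3)[of w] by simp
    then have "w \<in> ocomp L"
      using Z0 orth_proj_eq_zero_iff[OF cL] by blast
    then have "cinner w x = 0"
      using x by (simp add: ocomp_def)
    moreover have "cinner w (orth_proj ?C x) = 0"
      unfolding w_def by (intro orth_proj_orth[OF C] orth_proj_in[OF C])
    ultimately have "cinner w w = 0"
      by (simp add: w_def cinner_diff_right)
    then have "x = orth_proj ?C x"
      by (simp add: w_def)
    then show "x \<in> ?C"
      using orth_proj_in[OF C] by metis
  qed
  ultimately show ?thesis
    using U(1) by (intro bexI[of _ U]) auto
qed

text \<open>An isometry \<open>W\<close> of \<open>L\<close> into itself is transported to \<open>U L\<close> and extended by the identity on
  the complement of \<open>U L\<close> in \<open>L'\<close>.\<close>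

lemma fin_isometric:
  assumes U: "U \<in> A" and L: "affiliated A L" and L': "fin A L'"
    and iso: "\<And>x. x \<in> L \<Longrightarrow> U x \<in> L' \<and> norm (U x) = norm x"
  shows "fin A L"
  unfolding fin_def
proof (intro conjI L ballI impI subsetI)
  fix W y assume W: "W \<in> A" and Wiso: "\<forall>x\<in>L. W x \<in> L \<and> norm (W x) = norm x" and y: "y \<in> L"
  note Ub = bounded[OF U] and Wb = bounded[OF W]
  note cL = affiliatedD(1,2)[OF L]
  have aL': "affiliated A L'"
    using L' by (simp add: fin_def)
  note cL' = affiliatedD(1,2)[OF aL']
  define R where "R = U ` L"
  have cR: "csubsp R" "closed R"
    using iso unfolding R_def
    by (auto intro!: csubsp_image Ub cL closed_image_bounded_below[where e=1])
  have RL': "R \<subseteq> L'"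
    using iso by (auto simp: R_def)
  define M where "M = L' \<inter> ocomp R"
  have cM: "csubsp M"
    using cL'(1) csubsp_ocomp[of R] by (auto simp: M_def csubsp_def)
  have ULR: "U x \<in> R" if "x \<in> L" for x
    using that by (simp add: R_def)
  have orth: "cinner (U x) w = 0" if "x \<in> L" "w \<in> M" for x w
    using that ULR cinner_eq_zero_commute by (force simp: M_def ocomp_def)
  let ?G = "(\<lambda>(x, w). (U x + w, U (W x) + w)) ` (L \<times> M)"
  have "\<exists>V\<in>A. \<forall>(x, y)\<in>?G. V x = y"
  proof (rule isometric_relation_extends)
    show "csubsp ?G"
      unfolding csubsp_def
    proof (intro conjI ballI allI; (elim imageE)?)
      show "0 \<in> ?G"
        by (rule image_eqI[of _ _ "(0, 0)"])
          (simp_all add: zero_prod_def bounded_opsD(5)[OF Ub] bounded_opsD(5)[OF Wb] csubspD[OF cL(1)] csubspD[OF cM])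
      fix p q a b c
      assume "p = (case a of (x, w) \<Rightarrow> (U x + w, U (W x) + w))" "a \<in> L \<times> M"
      moreover assume "q = (case b of (x, w) \<Rightarrow> (U x + w, U (W x) + w))" "b \<in> L \<times> M"
      ultimately show "p + q \<in> ?G"
        by (intro image_eqI[of _ _ "a + b"])
          (auto simp: bounded_opsD(2)[OF Ub] bounded_opsD(2)[OF Wb] csubspD[OF cL(1)] csubspD[OF cM] add_ac)
    next
      fix p a c
      assume "p = (case a of (x, w) \<Rightarrow> (U x + w, U (W x) + w))" "a \<in> L \<times> M"
      then show "c *\<^sub>C p \<in> ?G"
        by (intro image_eqI[of _ _ "c *\<^sub>C a"])
          (auto simp: scaleC_prod_def scaleC_add_right bounded_opsD(6)[OF Ub] bounded_opsD(6)[OF Wb] csubspD[OF cL(1)] csubspD[OF cM])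
    qed
    show "norm a = norm b" if ab: "(a, b) \<in> ?G" for a b
    proof -
      obtain x w where *: "a = U x + w" "b = U (W x) + w" "x \<in> L" "w \<in> M"
        using ab by auto
      then have "(norm a)\<^sup>2 = (norm b)\<^sup>2"
        using Wiso iso by (simp add: norm_add_orth_sq orth)
      then show ?thesis
        by (simp add: power2_eq_iff_nonneg)
    qed
    fix c a b
    assume c: "c \<in> commutant A" and ab: "(a, b) \<in> ?G"
    then obtain x w where *: "a = U x + w" "b = U (W x) + w" "x \<in> L" "w \<in> M"
      by auto
    have "c w \<in> M"
    proof -
      have "cinner (c w) z = 0" if "z \<in> R" for z
      proof -
        have "cadjoint c z \<in> R"
          using that affiliatedD(3)[OF L cadjoint_commutant[OF c]]
          by (auto simp: R_def commute[OF cadjoint_commutant[OF c] U, symmetric])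
        then show ?thesis
          using *(4) by (simp add: cadjoint(1)[OF commutant_bounded[OF c]] M_def ocomp_def)
      qed
      then show ?thesis
        using *(4) affiliatedD(3)[OF aL' c] by (simp add: M_def ocomp_def)
    qed
    moreover have "(c a, c b) = (U (c x) + c w, U (W (c x)) + c w)"
      by (simp add: * commute[OF c U] commute[OF c W] bounded_opsD(2)[OF commutant_bounded[OF c]])
    ultimately show "(c a, c b) \<in> ?G"
      using affiliatedD(3)[OF L c *(3)] by (intro image_eqI[of _ _ "(c x, c w)"]) auto
  qed
  then obtain V where V: "V \<in> A" "\<And>x w. x \<in> L \<Longrightarrow> w \<in> M \<Longrightarrow> V (U x + w) = U (W x) + w"
    by auto
  have dec: "\<exists>x\<in>L. \<exists>w\<in>M. z = U x + w" if z: "z \<in> L'" for z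
  proof -
    have p: "orth_proj R z \<in> R"
      by (rule orth_proj_in[OF cR])
    then obtain x where x: "x \<in> L" "orth_proj R z = U x"
      by (auto simp: R_def)
    have "z - orth_proj R z \<in> M"
      using orth_proj_diff_ocomp[OF cR] csubspD(4)[OF cL'(1) z] p RL' by (auto simp: M_def)
    then show ?thesis
      using x by (intro bexI[of _ x] bexI[of _ "z - orth_proj R z"]) auto
  qed
  have "\<forall>z\<in>L'. V z \<in> L' \<and> norm (V z) = norm z"
  proof
    fix z assume "z \<in> L'"
    then obtain x w where *: "x \<in> L" "w \<in> M" "z = U x + w"
      using dec by blast
    then have "(norm (V z))\<^sup>2 = (norm z)\<^sup>2"
      using Wiso iso by (simp add: V norm_add_orth_sq orth)
    moreover have "V z \<in> L'"
      using * Wiso ULR RL' by (auto simp: V M_def intro!: csubspD(2)[OF cL'(1)])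
    ultimately show "V z \<in> L' \<and> norm (V z) = norm z"
      by (simp add: power2_eq_iff_nonneg)
  qed
  then have "L' \<subseteq> V ` L'"
    using L' V(1) by (simp add: fin_def)
  moreover have "U y \<in> L'"
    using iso y by simp
  ultimately obtain z where z: "z \<in> L'" "U y = V z"
    by blast
  then obtain x w where *: "x \<in> L" "w \<in> M" "z = U x + w"
    using dec by blast
  \<comment> \<open>This vector lies in \<open>R\<close> on the left and in \<open>M\<close>, the
    complement of \<open>R\<close> in \<open>L'\<close>, on the right; so it is 0, and
    \<open>y = W x\<close>.\<close>
  then have eq: "U (y - W x) = w"
    using z by (simp add: V bounded_opsD(3)[OF Ub])
  have yW: "y - W x \<in> L"
    using Wiso * y by (intro csubspD[OF cL(1)]) auto
  have "cinner w w = 0"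
    using orth[OF yW *(2)] eq by simp
  then have "norm (y - W x) = 0"
    using iso[OF yW] eq by simp
  then show "y \<in> W ` L"
    using * by auto
qed

text \<open>Polar decomposition trades the injective \<open>X\<close> for an isometry with the same
  source and target subspaces, and finiteness is inherited along isometries.\<close>

lemma fin_injective:
  assumes "X \<in> A" "affiliated A L" "fin A L'"
    "\<And>x. x \<in> L \<Longrightarrow> X x \<in> L'" "\<And>x. x \<in> L \<Longrightarrow> X x = 0 \<Longrightarrow> x = 0"
  shows "fin A L"
proof -
  have "affiliated A L'"
    using assms(3) by (simp add: fin_def)
  then obtain U where "U \<in> A" "\<forall>x\<in>L. U x \<in> L' \<and> norm (U x) = norm x"
    using injective_imp_isometric[OF assms(1,2) affiliatedD(2,1) assms(4,5)] by blast
  then show ?thesis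
    using fin_isometric[OF _ assms(2,3)] by blast
qed

lemma fin_mono: "fin A L' \<Longrightarrow> affiliated A L \<Longrightarrow> L \<subseteq> L' \<Longrightarrow> fin A L"
  using fin_injective[OF id_mem] by auto

end

section \<open>Comparison and sums of finite projections\<close>


lemma finD: "fin A L \<Longrightarrow> V \<in> A \<Longrightarrow> \<forall>x\<in>L. V x \<in> L \<and> norm (V x) = norm x \<Longrightarrow> L \<subseteq> V ` L"
  by (simp add: fin_def)

section \<open>Wandering subspaces of an isometry\<close>

text \<open>The linear span of the images of \<open>D\<close> under the even powers of
  \<open>V\<close>. The inductive form lets invariance and orthogonality go by rule induction, with
  no indices or finite sums.\<close>

inductive_set even_orbit :: "('h::chilbert_space \<Rightarrow> 'h) \<Rightarrow> 'h set \<Rightarrow> 'h set" for V D where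
  base: "x \<in> D \<Longrightarrow> x \<in> even_orbit V D"
| zero: "0 \<in> even_orbit V D"
| step: "x \<in> even_orbit V D \<Longrightarrow> V (V x) \<in> even_orbit V D"
| add: "x \<in> even_orbit V D \<Longrightarrow> y \<in> even_orbit V D \<Longrightarrow> x + y \<in> even_orbit V D"
| scaleC: "x \<in> even_orbit V D \<Longrightarrow> c *\<^sub>C x \<in> even_orbit V D"

lemma even_orbit_subset:
  assumes "D \<subseteq> L" "csubsp L" "\<And>x. x \<in> L \<Longrightarrow> V x \<in> L"
  shows "even_orbit V D \<subseteq> L"
proof
  show "x \<in> L" if "x \<in> even_orbit V D" for x
    using that by (induction rule: even_orbit.induct) (use assms csubspD(1,2,3)[OF assms(2)] in auto)
qed

text \<open>An isometry can be cancelled from both arguments of the inner product. One argument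
  carries an even and the other an odd number of factors \<open>V\<close>, so cancelling ends with
  one vector in \<open>D\<close> and the other in the image of \<open>L\<close>, to which
  \<open>D\<close> is orthogonal.\<close>

lemma even_orbit_orth_image:
  assumes V: "V \<in> bounded_ops" and L: "csubsp L" and iso: "\<And>x. x \<in> L \<Longrightarrow> V x \<in> L \<and> norm (V x) = norm x"
    and D: "D \<subseteq> L \<inter> ocomp (V ` L)"
    and a: "a \<in> even_orbit V D" and b: "b \<in> even_orbit V D"
  shows "cinner a (V b) = 0"
proof -
  have sub: "x \<in> L" if "x \<in> even_orbit V D" for x
    using even_orbit_subset[of D L V] that L iso D by blast
  have D0: "cinner x (V y) = 0" "cinner (V y) x = 0" if "x \<in> D" "y \<in> L" for x y
    using that D cinner_eq_zero_commute[of x "V y"] by (auto simp: ocomp_def)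
  have iso2: "cinner (V x) (V y) = cinner x y" if "x \<in> L" "y \<in> L" for x y
    using isometric_on_cinner[OF V L] iso that by blast
  \<comment> \<open>Cancelling one \<open>V\<close> from \<open>V (V y)\<close> and
    \<open>V b\<close> leaves the odd power on the left; this swapped case has its own induction, on
    the right argument.\<close>
  have *: "cinner (V y) x = 0" if y: "y \<in> even_orbit V D"
    and IH: "\<And>b. b \<in> even_orbit V D \<Longrightarrow> cinner y (V b) = 0" and x: "x \<in> even_orbit V D" for x y
    using x
  proof (induction rule: even_orbit.induct)
    case (step b)
    then show ?case
      using iso2[of y "V b"] sub[OF y] sub[OF step.hyps] iso IH by simp
  qed (use D0 sub[OF y] in \<open>auto simp: cinner_simps\<close>)
  show ?thesis
    using a b
  proof (induction arbitrary: b rule: even_orbit.induct)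
    case (step y)
    have "cinner (V (V y)) (V b) = cinner (V y) b"
      using sub[OF step.hyps] sub[OF step.prems] iso by (intro iso2) auto
    then show ?case
      using *[OF step.hyps step.IH step.prems] by simp
  qed (auto simp: cinner_simps D0 sub)
qed

section \<open>Comparison of subspaces up to a central projection\<close>

context vna
begin

lemma affiliated_Int_ocomp_closure:
  assumes "affiliated A E" "csubsp R" "\<And>c x. c \<in> commutant A \<Longrightarrow> x \<in> R \<Longrightarrow> c x \<in> R"
  shows "affiliated A (E \<inter> ocomp R)"
proof -
  have "affiliated A (closure R)"
    by (rule affiliated_closure) (fact assms)+
  then show ?thesis
    using affiliated_Int[OF assms(1) affiliated_ocomp] by (metis ocomp_closure)
qed

text \<open>The graph of a partial isometry between parts of \<open>E\<close> and \<open>F\<close>.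
  As a set of pairs it can be reversed, and since closedness is not demanded, the union of a chain
  is again of this kind, as Zorn's lemma requires.\<close>

definition isometric_relation :: "'h set \<Rightarrow> 'h set \<Rightarrow> ('h \<times> 'h) set \<Rightarrow> bool" where
  "isometric_relation E F R \<longleftrightarrow> csubsp R \<and> R \<subseteq> E \<times> F \<and> (\<forall>(x, y)\<in>R. norm x = norm y) \<and>
     (\<forall>c\<in>commutant A. \<forall>(x, y)\<in>R. (c x, c y) \<in> R)"

lemma isometric_relation_converse:
  assumes "isometric_relation E F R"
  shows "isometric_relation F E (R\<inverse>)"
proof -
  have "csubsp (R\<inverse>)"
  proof -
    have R: "csubsp R"
      using assms by (simp add: isometric_relation_def)
    show ?thesis
      unfolding csubsp_def
      using csubspD(1)[OF R] csubspD(2)[OF R, of "(_, _)" "(_, _)"] csubspD(3)[OF R, of "(_, _)"]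
      by (auto simp: zero_prod_def scaleC_prod_def)
  qed
  then show ?thesis
    using assms by (fastforce simp: isometric_relation_def)
qed

lemma csubsp_fst: "csubsp R \<Longrightarrow> csubsp (fst ` R)"
  unfolding csubsp_def
proof (intro conjI ballI allI; (elim conjE imageE)?)
  assume R: "0 \<in> R" "\<forall>p\<in>R. \<forall>q\<in>R. p + q \<in> R" "\<forall>c. \<forall>p\<in>R. c *\<^sub>C p \<in> R"
  show "0 \<in> fst ` R"
    using R(1) by (intro image_eqI[of _ _ 0]) auto
  show "x + y \<in> fst ` R" if "x = fst p" "p \<in> R" "y = fst q" "q \<in> R" for x y p q
    using R(2) that by (intro image_eqI[of _ _ "p + q"]) auto
  show "c *\<^sub>C x \<in> fst ` R" if "x = fst p" "p \<in> R" for c x p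
    using R(3) that by (intro image_eqI[of _ _ "c *\<^sub>C p"]) (auto simp: scaleC_prod_def)
qed

lemma isometric_relation_affiliated:
  assumes "isometric_relation E F R" "affiliated A E"
  shows "affiliated A (E \<inter> ocomp (fst ` R))"
  using assms by (intro affiliated_Int_ocomp_closure csubsp_fst) (force simp: isometric_relation_def)+

text \<open>A vector of \<open>E\<close> orthogonal to the unmatched part of \<open>E\<close> lies
  in the closure of the domain of \<open>R\<close>, and the operator extending \<open>R\<close>
  stays isometric there by continuity.\<close>

lemma isometric_relation_operator:
  assumes R: "isometric_relation E F R" and E: "affiliated A E" and F: "closed F"
  shows "\<exists>U\<in>A. \<forall>x\<in>E. (\<forall>z \<in> E \<inter> ocomp (fst ` R). cinner x z = 0) \<longrightarrow> U x \<in> F \<and> norm (U x) = norm x"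
proof -
  let ?C = "closure (fst ` R)"
  have cR: "csubsp R" and sub: "R \<subseteq> E \<times> F" and iso: "\<And>x y. (x, y) \<in> R \<Longrightarrow> norm x = norm y"
    and inv: "\<And>c x y. c \<in> commutant A \<Longrightarrow> (x, y) \<in> R \<Longrightarrow> (c x, c y) \<in> R"
    using R by (auto simp: isometric_relation_def)
  have "\<exists>U\<in>A. \<forall>(x, y)\<in>R. U x = y"
    by (rule isometric_relation_extends) (fact cR iso inv)+
  then obtain U where UA: "U \<in> A" and UR: "\<forall>(x, y)\<in>R. U x = y"
    by blast
  have U: "U \<in> A" "\<And>x y. (x, y) \<in> R \<Longrightarrow> U x = y"
    using UA UR by auto
  have C: "csubsp ?C" "closed ?C"
    using cR by (auto intro: csubsp_closure csubsp_fst)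
  have CE: "?C \<subseteq> E"
    using sub affiliatedD(2)[OF E] by (intro closure_minimal) auto
  have "?C \<subseteq> U -` F \<inter> {x. norm (U x) = norm x}"
  proof (rule closure_minimal)
    show "fst ` R \<subseteq> U -` F \<inter> {x. norm (U x) = norm x}"
    proof
      fix x assume "x \<in> fst ` R"
      then obtain y where "(x, y) \<in> R"
        by auto
      then show "x \<in> U -` F \<inter> {x. norm (U x) = norm x}"
        using U(2) iso sub by auto
    qed
    show "closed (U -` F \<inter> {x. norm (U x) = norm x})"
      by (intro closed_Int closed_vimage closed_Collect_eq continuous_on_norm F
          continuous_on_bounded_ops[OF bounded[OF U(1)]] continuous_on_id)
  qed
  moreover have "x \<in> ?C" if x: "x \<in> E" and orth: "\<forall>z \<in> E \<inter> ocomp (fst ` R). cinner x z = 0" for x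
  proof -
    have p: "orth_proj ?C x \<in> ?C"
      by (rule orth_proj_in[OF C])
    then have "x - orth_proj ?C x \<in> E"
      using CE x csubspD(4)[OF affiliatedD(1)[OF E]] by blast
    then have "cinner x (x - orth_proj ?C x) = 0"
      using orth orth_proj_diff_ocomp[OF C] by (simp add: ocomp_closure)
    moreover have "cinner (orth_proj ?C x) (x - orth_proj ?C x) = 0"
      using orth_proj_orth_right[OF C p] .
    ultimately have "cinner (x - orth_proj ?C x) (x - orth_proj ?C x) = 0"
      by (simp add: cinner_diff_left)
    then show ?thesis
      using p by simp
  qed
  ultimately show ?thesis
    using U(1) by (intro bexI[of _ U]) auto
qed

lemma maximal_isometric_relation:
  assumes E: "affiliated A E" and F: "affiliated A F"
  shows "\<exists>R. isometric_relation E F R \<and> (\<forall>R'. isometric_relation E F R' \<longrightarrow> R \<subseteq> R' \<longrightarrow> R' = R)"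
proof -
  have "\<exists>M\<in>Collect (isometric_relation E F). \<forall>X\<in>Collect (isometric_relation E F). M \<subseteq> X \<longrightarrow> X = M"
  proof (rule subset_Zorn_nonempty)
    have "isometric_relation E F {0}"
      using affiliatedD(1)[OF E] affiliatedD(1)[OF F]
      by (auto simp: isometric_relation_def csubsp_def zero_prod_def scaleC_prod_def
          bounded_opsD(5)[OF commutant_bounded])
    then show "Collect (isometric_relation E F) \<noteq> {}"
      by blast
    fix \<C> assume ne: "\<C> \<noteq> {}" and ch: "subset.chain (Collect (isometric_relation E F)) \<C>"
    have mem: "isometric_relation E F R" if "R \<in> \<C>" for R
      using that ch by (auto simp: subset.chain_def)
    have "csubsp (\<Union>\<C>)"
      unfolding csubsp_def
    proof (intro conjI ballI allI)
      show "0 \<in> \<Union>\<C>"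
        using ne mem by (fastforce simp: isometric_relation_def csubsp_def)
      show "c *\<^sub>C p \<in> \<Union>\<C>" if "p \<in> \<Union>\<C>" for c p
        using that mem unfolding isometric_relation_def csubsp_def by blast
      fix p q assume "p \<in> \<Union>\<C>" "q \<in> \<Union>\<C>"
      then obtain R S where RS: "p \<in> R" "R \<in> \<C>" "q \<in> S" "S \<in> \<C>"
        by blast
      then have "R \<subseteq> S \<or> S \<subseteq> R"
        using ch unfolding subset_chain_def by blast
      then obtain M where "M \<in> \<C>" "p \<in> M" "q \<in> M"
        using RS by blast
      then show "p + q \<in> \<Union>\<C>"
        using mem unfolding isometric_relation_def csubsp_def by blast
    qed
    then show "\<Union>\<C> \<in> Collect (isometric_relation E F)"
      using mem unfolding isometric_relation_def by fastforce
  qed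
  then show ?thesis
    by blast
qed

text \<open>If the compression \<open>T\<close> of \<open>X\<close> to the unmatched parts
  \<open>E1\<close> and \<open>F1\<close> were nonzero on \<open>E1\<close>, it would be injective
  on a nonzero \<open>M\<close>, the complement of its kernel in \<open>E1\<close>. Polar
  decomposition then gives an isometry \<open>U\<close> of \<open>M\<close> into \<open>F1\<close>,
  and adding its graph to \<open>R\<close> would contradict maximality.\<close>

lemma maximal_isometric_relation_orth:
  assumes E: "affiliated A E" and F: "affiliated A F"
    and R: "isometric_relation E F R" and max: "\<And>R'. isometric_relation E F R' \<Longrightarrow> R \<subseteq> R' \<Longrightarrow> R' = R"
    and X: "X \<in> A" and x: "x \<in> E \<inter> ocomp (fst ` R)" and y: "y \<in> F \<inter> ocomp (snd ` R)"
  shows "cinner (X x) y = 0"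
proof -
  define E1 where "E1 = E \<inter> ocomp (fst ` R)"
  define F1 where "F1 = F \<inter> ocomp (snd ` R)"
  have E1: "affiliated A E1"
    unfolding E1_def by (rule isometric_relation_affiliated[OF R E])
  have "fst ` R\<inverse> = snd ` R"
    by force
  then have F1: "affiliated A F1"
    unfolding F1_def using isometric_relation_affiliated[OF isometric_relation_converse[OF R] F] by simp
  note cE1 = affiliatedD(1,2)[OF E1] and cF1 = affiliatedD(1,2)[OF F1]
  have cR: "csubsp R" and sub: "R \<subseteq> E \<times> F" and iso: "\<And>x y. (x, y) \<in> R \<Longrightarrow> norm x = norm y"
    and inv: "\<And>c x y. c \<in> commutant A \<Longrightarrow> (x, y) \<in> R \<Longrightarrow> (c x, c y) \<in> R"
    using R by (auto simp: isometric_relation_def)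
  define T where "T z = orth_proj F1 (X z)" for z
  have T: "T \<in> A"
    unfolding T_def by (rule comp_mem'[OF orth_proj_mem[OF F1] X])
  define K where "K = E1 \<inter> {z. T z = 0}"
  have K: "affiliated A K"
    unfolding K_def by (rule affiliated_Int[OF E1 affiliated_ker[OF T]])
  note cK = affiliatedD(1,2)[OF K]
  define M where "M = E1 \<inter> ocomp K"
  have M: "affiliated A M"
    unfolding M_def by (rule affiliated_Int[OF E1 affiliated_ocomp[OF K]])
  note cM = affiliatedD(1,2)[OF M]
  have inj: "z = 0" if "z \<in> M" "T z = 0" for z
  proof -
    have "cinner z z = 0"
      using that by (auto simp: M_def K_def ocomp_def)
    then show ?thesis
      by simp
  qed
  have "T z \<in> F1" for z
    unfolding T_def by (rule orth_proj_in[OF cF1])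
  then obtain U where U: "U \<in> A" "\<And>z. z \<in> M \<Longrightarrow> U z \<in> F1 \<and> norm (U z) = norm z"
    using injective_imp_isometric[OF T M cF1(2,1) _ inj] by blast
  note Ub = bounded[OF U(1)]
  let ?R = "(\<lambda>(p, z). p + (z, U z)) ` (R \<times> M)"
  have RI: "p + (z, U z) \<in> ?R" if "p \<in> R" "z \<in> M" for p z
    using that by (intro image_eqI[of _ _ "(p, z)"]) auto
  have "isometric_relation E F ?R"
    unfolding isometric_relation_def
  proof (intro conjI)
    show "csubsp ?R"
      unfolding csubsp_def
    proof (intro conjI ballI allI)
      show "0 \<in> ?R"
        using RI[OF csubspD(1)[OF cR] csubspD(1)[OF cM(1)]] by (simp add: bounded_opsD(5)[OF Ub] flip: zero_prod_def)
      fix p assume "p \<in> ?R"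
      then obtain r z where rz: "p = r + (z, U z)" "r \<in> R" "z \<in> M"
        by auto
      show "c *\<^sub>C p \<in> ?R" for c
        using RI[of "c *\<^sub>C r" "c *\<^sub>C z"] csubspD(3)[OF cR rz(2), of c] csubspD(3)[OF cM(1) rz(3), of c]
        by (simp add: rz(1) scaleC_add_right bounded_opsD(6)[OF Ub]) (simp add: scaleC_prod_def)
      fix q assume "q \<in> ?R"
      then obtain s w where sw: "q = s + (w, U w)" "s \<in> R" "w \<in> M"
        by auto
      have "p + q = (r + s) + (z + w, U (z + w))"
        by (simp add: rz sw bounded_opsD(2)[OF Ub] algebra_simps flip: add_Pair)
      then show "p + q \<in> ?R"
        using RI[OF csubspD(2)[OF cR rz(2) sw(2)] csubspD(2)[OF cM(1) rz(3) sw(3)]] by simp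
    qed
    have *: "\<exists>a b z. p = (a + z, b + U z) \<and> (a, b) \<in> R \<and> z \<in> M" if "p \<in> ?R" for p
      using that by force
    show "?R \<subseteq> E \<times> F"
    proof
      fix p assume "p \<in> ?R"
      then obtain a b z where p: "p = (a + z, b + U z)" "(a, b) \<in> R" "z \<in> M"
        using * by blast
      have "a \<in> E" "b \<in> F" "z \<in> E" "U z \<in> F"
        using p sub U(2)[OF p(3)] by (auto simp: M_def E1_def F1_def)
      then show "p \<in> E \<times> F"
        using csubspD(2)[OF affiliatedD(1)[OF E]] csubspD(2)[OF affiliatedD(1)[OF F]] by (simp add: p(1))
    qed
    show "\<forall>(x, y)\<in>?R. norm x = norm y"
    proof
      fix q assume "q \<in> ?R"
      then obtain a b z where q: "q = (a + z, b + U z)" and p: "(a, b) \<in> R" "z \<in> M"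
        using * by blast
      have "cinner z a = 0" "cinner (U z) b = 0"
        using p U(2)[OF p(2)] by (force simp: M_def E1_def F1_def ocomp_def)+
      then have "cinner a z = 0" "cinner b (U z) = 0"
        using cinner_eq_zero_commute by blast+
      then have "(norm (a + z))\<^sup>2 = (norm (b + U z))\<^sup>2"
        using iso[OF p(1)] U(2)[OF p(2)] by (simp add: norm_add_orth_sq)
      then show "case q of (x, y) \<Rightarrow> norm x = norm y"
        by (simp add: q power2_eq_iff_nonneg)
    qed
    show "\<forall>c\<in>commutant A. \<forall>(x, y)\<in>?R. (c x, c y) \<in> ?R"
    proof (intro ballI)
      fix c q assume c: "c \<in> commutant A" and "q \<in> ?R"
      then obtain a b z where q: "q = (a + z, b + U z)" and ab: "(a, b) \<in> R" "z \<in> M"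
        using * by blast
      note p = c ab
      have "(c a, c b) + (c z, U (c z)) \<in> ?R"
        by (rule RI[OF inv[OF p(1,2)] affiliatedD(3)[OF M p(1,3)]])
      then show "case q of (x, y) \<Rightarrow> (c x, c y) \<in> ?R"
        by (simp add: q bounded_opsD(2)[OF commutant_bounded[OF p(1)]] commute[OF p(1) U(1)])
    qed
  qed
  moreover have "R \<subseteq> ?R"
  proof
    fix p assume "p \<in> R"
    from RI[OF this csubspD(1)[OF cM(1)]] show "p \<in> ?R"
      by (simp add: bounded_opsD(5)[OF Ub] flip: zero_prod_def)
  qed
  ultimately have eq: "?R = R"
    by (rule max)
  have M0: "z = 0" if z: "z \<in> M" for z
  proof -
    have "(z, U z) \<in> R"
      using RI[OF csubspD(1)[OF cR] z] eq by simp
    then have "cinner z z = 0"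
      using z by (force simp: M_def E1_def ocomp_def)
    then show ?thesis
      by simp
  qed
  have xE: "x \<in> E1" and yF: "y \<in> F1"
    using x y by (auto simp: E1_def F1_def)
  have "x - orth_proj K x \<in> M"
    using orth_proj_diff_ocomp[OF cK] orth_proj_in[OF cK, of x] csubspD(4)[OF cE1(1) xE]
    by (auto simp: M_def K_def)
  then have "x \<in> K"
    using M0 orth_proj_in[OF cK, of x] by fastforce
  then have "X x \<in> ocomp F1"
    using orth_proj_diff_ocomp[OF cF1, of "X x"] by (simp add: T_def K_def)
  then show ?thesis
    using yF by (simp add: ocomp_def)
qed

text \<open>\<open>W\<close> is the range of a central projection, being invariant under the algebra
  and its commutant. It is chosen as the complement of everything the algebra produces from the
  unmatched part of \<open>E\<close>. Hence \<open>E \<inter> W\<close> is orthogonal to that part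
  and embeds into \<open>F\<close>; by maximality \<open>W\<close> contains the unmatched part of
  \<open>F\<close>, so \<open>F \<inter> ocomp W\<close> embeds into \<open>E\<close>.\<close>

lemma comparison:
  assumes E: "affiliated A E" and F: "affiliated A F"
  shows "\<exists>W U U'. affiliated A W \<and> (\<forall>X\<in>A. \<forall>x\<in>W. X x \<in> W) \<and> U \<in> A \<and> U' \<in> A \<and>
    (\<forall>x\<in>E \<inter> W. U x \<in> F \<and> norm (U x) = norm x) \<and>
    (\<forall>y\<in>F \<inter> ocomp W. U' y \<in> E \<and> norm (U' y) = norm y)"
proof -
  obtain R where R: "isometric_relation E F R"
    and max: "\<And>R'. isometric_relation E F R' \<Longrightarrow> R \<subseteq> R' \<Longrightarrow> R' = R"
    using maximal_isometric_relation[OF E F] by blast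
  let ?E = "E \<inter> ocomp (fst ` R)" and ?F = "F \<inter> ocomp (snd ` R)"
  have fR: "fst ` R\<inverse> = snd ` R"
    by force
  define W where "W = ocomp {X x | X x. X \<in> A \<and> x \<in> ?E}"
  have W: "cinner y (X x) = 0" if "y \<in> W" "X \<in> A" "x \<in> ?E" for X x y
    using that unfolding W_def ocomp_def by blast
  have WI: "y \<in> W" if "\<And>X x. X \<in> A \<Longrightarrow> x \<in> ?E \<Longrightarrow> cinner y (X x) = 0" for y
    using that unfolding W_def ocomp_def by blast
  have E1: "affiliated A ?E"
    by (rule isometric_relation_affiliated[OF R E])
  have "c y \<in> W" if c: "c \<in> commutant A" and y: "y \<in> W" for c y
  proof (rule WI)
    fix X x assume "X \<in> A" "x \<in> ?E"
    then show "cinner (c y) (X x) = 0"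
      using W[OF y \<open>X \<in> A\<close> affiliatedD(3)[OF E1 cadjoint_commutant[OF c]]]
      by (simp add: cadjoint(1)[OF commutant_bounded[OF c]] commute[OF cadjoint_commutant[OF c]])
  qed
  then have aW: "affiliated A W"
    unfolding affiliated_def by (auto simp: W_def csubsp_ocomp closed_ocomp)
  have invW: "Y y \<in> W" if Y: "Y \<in> A" and y: "y \<in> W" for Y y
  proof (rule WI)
    fix X x assume "X \<in> A" "x \<in> ?E"
    then show "cinner (Y y) (X x) = 0"
      using W[OF y comp_mem[OF cadjoint_mem[OF Y]]] by (simp add: cadjoint(1)[OF bounded[OF Y]])
  qed
  have EW: "cinner x z = 0" if "x \<in> W" "z \<in> ?E" for x z
    using W[OF that(1) id_mem that(2)] by simp
  have FW: "z \<in> W" if "z \<in> ?F" for z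
    using maximal_isometric_relation_orth[OF E F R max _ _ that] cinner_eq_zero_commute by (blast intro: WI)
  obtain U where U: "U \<in> A" "\<And>x. x \<in> E \<Longrightarrow> \<forall>z\<in>?E. cinner x z = 0 \<Longrightarrow> U x \<in> F \<and> norm (U x) = norm x"
    using isometric_relation_operator[OF R E affiliatedD(2)[OF F]] by blast
  obtain U' where U': "U' \<in> A" "\<And>x. x \<in> F \<Longrightarrow> \<forall>z\<in>?F. cinner x z = 0 \<Longrightarrow> U' x \<in> E \<and> norm (U' x) = norm x"
    using isometric_relation_operator[OF isometric_relation_converse[OF R] F affiliatedD(2)[OF E]]
    unfolding fR by blast
  have "U x \<in> F \<and> norm (U x) = norm x" if "x \<in> E \<inter> W" for x
    using U(2) EW that by blast
  moreover have "U' y \<in> E \<and> norm (U' y) = norm y" if "y \<in> F \<inter> ocomp W" for y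
    using U'(2) FW that unfolding ocomp_def[of W] by blast
  ultimately show ?thesis
    using aW invW U(1) U'(1) by blast
qed

section \<open>Sums of finite subspaces\<close>

text \<open>The map into \<open>K\<close> keeps the \<open>K\<close>-component of \<open>g\<close>
  and adds the image under \<open>U\<close> of the projection of \<open>g\<close> onto
  \<open>G \<inter> K'\<close>. That image lies in \<open>G2\<close>, orthogonal to
  \<open>G\<close>, so the two terms are orthogonal and cannot cancel. If both vanish, then
  \<open>g\<close> lies in \<open>K'\<close>, hence equals its projection onto
  \<open>G \<inter> K'\<close>, which is 0.\<close>

lemma fin_central_part:
  assumes G: "affiliated A G" and GL: "G \<subseteq> L" and W: "affiliated A W" "\<forall>X\<in>A. \<forall>x\<in>W. X x \<in> W"
    and K: "fin A K" and K': "affiliated A K'"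
    and compl: "\<And>g. g \<in> L \<Longrightarrow> orth_proj K g = 0 \<Longrightarrow> g \<in> K'"
    and U: "U \<in> A" "\<And>x. x \<in> G \<inter> K' \<inter> W \<Longrightarrow> U x \<in> G2 \<inter> K \<and> norm (U x) = norm x"
    and orth: "\<And>x y. x \<in> G2 \<Longrightarrow> y \<in> G \<Longrightarrow> cinner x y = 0"
  shows "fin A (G \<inter> W)"
proof (rule fin_injective[OF _ _ K])
  let ?P = "orth_proj (G \<inter> K')"
  have aK: "affiliated A K"
    using K by (simp add: fin_def)
  note cK = affiliatedD(1,2)[OF aK]
  have E: "affiliated A (G \<inter> K')"
    by (rule affiliated_Int[OF G K'])
  note cE = affiliatedD(1,2)[OF E]
  show "(\<lambda>g. U (?P g) + orth_proj K g) \<in> A"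
    by (rule add_mem[OF comp_mem'[OF U(1) orth_proj_mem[OF E]] orth_proj_mem[OF aK]])
  show "affiliated A (G \<inter> W)"
    by (rule affiliated_Int[OF G W(1)])
  fix g assume g: "g \<in> G \<inter> W"
  have PW: "?P g \<in> G \<inter> K' \<inter> W"
    using orth_proj_in[OF cE] bspec[OF W(2) orth_proj_mem[OF E]] g by blast
  show "U (?P g) + orth_proj K g \<in> K"
    using U(2)[OF PW] orth_proj_in[OF cK] csubspD(2)[OF cK(1)] by blast
  assume eq: "U (?P g) + orth_proj K g = 0"
  have u: "U (?P g) \<in> G2" "U (?P g) \<in> K"
    using U(2)[OF PW] by auto
  then have "cinner (U (?P g)) (orth_proj K g) = 0"
    using orth_proj_selfadj[OF cK, of "U (?P g)" g, symmetric] orth[OF u(1)] g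
    by (simp add: orth_proj_id[OF cK(1)])
  then have "(norm (U (?P g) + orth_proj K g))\<^sup>2 = (norm (U (?P g)))\<^sup>2 + (norm (orth_proj K g))\<^sup>2"
    by (rule norm_add_orth_sq)
  then have "norm (U (?P g)) = 0" "orth_proj K g = 0"
    using eq by (simp_all add: add_nonneg_eq_0_iff)
  then have P0: "?P g = 0" and "g \<in> K'"
    using U(2)[OF PW] compl GL g by auto
  then have "?P g = g"
    using g by (intro orth_proj_id[OF cE(1)]) auto
  then show "g = 0"
    using P0 by simp
qed

lemma central_orth_proj:
  assumes W: "affiliated A W" "\<forall>X\<in>A. \<forall>x\<in>W. X x \<in> W"
  shows "orth_proj W \<in> commutant A"
proof -
  note cW = affiliatedD(1,2)[OF W(1)]
  have "orth_proj W (X x) = X (orth_proj W x)" if "X \<in> A" for X x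
    using orth_proj_commute[OF cW bounded[OF that]] W(2) that cadjoint_mem by blast
  then show ?thesis
    by (auto simp: commutant_def orth_proj_bounded_ops[OF cW])
qed

text \<open>If \<open>V\<close> maps \<open>L\<close> isometrically onto a proper subspace, the wandering subspaces
  \<open>V\<^sup>n (L - V L)\<close> of even and of odd index span orthogonal subspaces \<open>G\<close> and \<open>G'\<close>, both moved
  properly into themselves by \<open>V\<^sup>2\<close>.  Comparing \<open>G \<inter> L1\<close> with \<open>G' \<inter> L2\<close> embeds a central
  part of \<open>G\<close> into \<open>L2\<close> and the complementary part of \<open>G'\<close> into \<open>L1\<close>.\<close>

lemma fin_orthogonal_sum:
  assumes L: "affiliated A L" and L1: "fin A L1" "L1 \<subseteq> L" and L2: "fin A (L \<inter> ocomp L1)"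
  shows "fin A L"
  unfolding fin_def
proof (intro conjI L ballI impI)
  fix V assume V: "V \<in> A" and iso': "\<forall>x\<in>L. V x \<in> L \<and> norm (V x) = norm x"
  then have iso: "\<And>x. x \<in> L \<Longrightarrow> V x \<in> L \<and> norm (V x) = norm x"
    by blast
  note Vb = bounded[OF V] and cL = affiliatedD(1,2)[OF L]
  have VL: "affiliated A (V ` L)"
    unfolding affiliated_def
  proof (intro conjI ballI)
    show "csubsp (V ` L)"
      by (rule csubsp_image[OF Vb cL(1)])
    show "closed (V ` L)"
      using iso by (intro closed_image_bounded_below[OF Vb cL, of 1]) auto
    show "c x \<in> V ` L" if "c \<in> commutant A" "x \<in> V ` L" for c x
      using that affiliatedD(3)[OF L that(1)] by (auto simp: commute[OF that(1) V, symmetric])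
  qed
  define D where "D = L \<inter> ocomp (V ` L)"
  have D: "affiliated A D"
    unfolding D_def by (intro affiliated_Int L affiliated_ocomp VL)
  have iV: "cinner (V x) (V y) = cinner x y" if "x \<in> L" "y \<in> L" for x y
    using isometric_on_cinner[OF Vb cL(1)] iso that by blast
  define S where "S = even_orbit V D"
  have SL: "S \<subseteq> L"
    unfolding S_def using D_def iso cL by (intro even_orbit_subset) auto
  have cS: "csubsp S"
    by (auto simp: csubsp_def S_def intro: even_orbit.intros)
  have Sinv: "c x \<in> S" if c: "c \<in> commutant A" and "x \<in> S" for c x
    using that(2) unfolding S_def
    by (induction rule: even_orbit.induct)
      (auto intro: even_orbit.intros affiliatedD(3)[OF D c]
        simp: commute[OF c V, symmetric] bounded_opsD(2,5,6)[OF commutant_bounded[OF c]])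
  have cVS: "csubsp (V ` S)"
    by (rule csubsp_image[OF Vb cS])
  have VSinv: "c x \<in> V ` S" if c: "c \<in> commutant A" and "x \<in> V ` S" for c x
    using that(2) Sinv[OF c] by (auto simp: commute[OF c V, symmetric])
  define G where "G = closure S"
  define G' where "G' = closure (V ` S)"
  have G: "affiliated A G" and G': "affiliated A G'"
    unfolding G_def G'_def using cS Sinv cVS VSinv by (auto intro: affiliated_closure)
  have GL: "G \<subseteq> L" and G'L: "G' \<subseteq> L"
    unfolding G_def G'_def using SL iso cL(2) by (intro closure_minimal; blast)+
  have DG: "D \<subseteq> G"
    unfolding G_def S_def using closure_subset by (force intro: even_orbit.base)
  have VDG': "V x \<in> G'" if "x \<in> D" for x
    unfolding G'_def S_def using that closure_subset by (force intro: even_orbit.base)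
  have VVG: "V (V x) \<in> G" if "x \<in> G" for x
    using closure_image_mem[OF bounded[OF comp_mem[OF V V]], of S S x] that
    by (auto simp: G_def S_def intro: even_orbit.step)
  have VVG': "V (V x) \<in> G'" if "x \<in> G'" for x
    using closure_image_mem[OF bounded[OF comp_mem[OF V V]], of "V ` S" "V ` S" x] that
    by (auto simp: G'_def S_def intro: even_orbit.step)
  have "S \<subseteq> ocomp (V ` S)"
    unfolding S_def ocomp_def using even_orbit_orth_image[OF Vb cL(1) iso, of D] by (auto simp: D_def)
  then have "G \<subseteq> ocomp G'"
    unfolding G_def G'_def ocomp_closure by (intro closure_minimal closed_ocomp)
  then have orth: "cinner x y = 0" "cinner y x = 0" if "x \<in> G" "y \<in> G'" for x y
    using that cinner_eq_zero_commute[of x y] by (auto simp: ocomp_def)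
  define L2 where "L2 = L \<inter> ocomp L1"
  have aL1: "affiliated A L1" and fL2: "fin A L2" and aL2: "affiliated A L2"
    using L1 L2 by (auto simp: fin_def L2_def)
  note cL1 = affiliatedD(1,2)[OF aL1] and cL2 = affiliatedD(1,2)[OF aL2]
  have compl1: "g \<in> L2" if "g \<in> L" "orth_proj L1 g = 0" for g
    using that orth_proj_eq_zero_iff[OF cL1] by (simp add: L2_def)
  have compl2: "g \<in> L1" if "g \<in> L" "orth_proj L2 g = 0" for g
  proof -
    have p: "orth_proj L1 g \<in> L1"
      by (rule orth_proj_in[OF cL1])
    have d: "g - orth_proj L1 g \<in> L2"
      using orth_proj_diff_ocomp[OF cL1] csubspD(4)[OF cL(1) that(1)] p L1(2) by (auto simp: L2_def)
    then have "cinner g (g - orth_proj L1 g) = 0"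
      using that(2) orth_proj_eq_zero_iff[OF cL2] by (simp add: ocomp_def)
    moreover have "cinner (orth_proj L1 g) (g - orth_proj L1 g) = 0"
      by (rule orth_proj_orth_right[OF cL1 p])
    ultimately have "cinner (g - orth_proj L1 g) (g - orth_proj L1 g) = 0"
      by (simp add: cinner_diff_left)
    then show ?thesis
      using p by simp
  qed
  obtain W U U' where aW: "affiliated A W" and invW: "\<forall>X\<in>A. \<forall>x\<in>W. X x \<in> W"
    and UA: "U \<in> A" "U' \<in> A"
    and UL: "\<forall>x\<in>G \<inter> L1 \<inter> W. U x \<in> G' \<inter> L2 \<and> norm (U x) = norm x"
    and U'L: "\<forall>y\<in>G' \<inter> L2 \<inter> ocomp W. U' y \<in> G \<inter> L1 \<and> norm (U' y) = norm y"
    using comparison[OF affiliated_Int[OF G aL1] affiliated_Int[OF G' aL2]] by (elim exE conjE)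
  have U: "U x \<in> G' \<inter> L2 \<and> norm (U x) = norm x" if "x \<in> G \<inter> L1 \<inter> W" for x
    using UL that by (rule bspec)
  have U': "U' y \<in> G \<inter> L1 \<and> norm (U' y) = norm y" if "y \<in> G' \<inter> L2 \<inter> Z" and "Z = ocomp W" for y Z
    using U'L that by simp
  define Z where "Z = ocomp W"
  have Z: "affiliated A Z"
    unfolding Z_def by (rule affiliated_ocomp[OF aW])
  have invZ: "\<forall>X\<in>A. \<forall>x\<in>Z. X x \<in> Z"
    using invW cadjoint_mem by (simp add: Z_def ocomp_def cadjoint(1)[OF bounded])
  note cW = affiliatedD(1,2)[OF aW] and cZ = affiliatedD(1,2)[OF Z]
  have fin1: "fin A (G \<inter> W)"
    by (rule fin_central_part[OF G GL aW invW fL2 aL1 compl2 UA(1) U]) (auto intro: orth)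
  have fin2: "fin A (G' \<inter> Z)"
    by (rule fin_central_part[OF G' G'L Z invZ L1(1) aL2 compl1 UA(2) U'[OF _ Z_def]]) (auto intro: orth)
  have D0: "d = 0" if "d \<in> D" "d \<in> V ` L" for d
  proof -
    have "cinner d d = 0"
      using that by (auto simp: D_def ocomp_def)
    then show ?thesis
      by simp
  qed
  have VV: "(\<lambda>x. V (V x)) \<in> A"
    by (rule comp_mem'[OF V V])
  \<comment> \<open>The central projection keeps \<open>d\<close> in \<open>D\<close>. On the finite
    \<open>G \<inter> W\<close> the isometry \<open>V \<circ> V\<close> is onto, so the projected
    vector lies in the image of \<open>V\<close>, to which \<open>D\<close> is orthogonal.\<close>
  have W0: "orth_proj W d = 0" if d: "d \<in> D" for d
  proof -
    let ?e = "orth_proj W d"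
    have e: "?e \<in> D" "?e \<in> W"
      using affiliatedD(3)[OF D central_orth_proj[OF aW invW] d] orth_proj_in[OF cW] by auto
    have "\<forall>x\<in>G \<inter> W. V (V x) \<in> G \<inter> W \<and> norm (V (V x)) = norm x"
      using VVG bspec[OF invW VV] GL iso by auto
    then have "G \<inter> W \<subseteq> (\<lambda>x. V (V x)) ` (G \<inter> W)"
      by (rule finD[OF fin1 VV])
    then have "?e \<in> V ` L"
      using e DG GL iso by blast
    then show ?thesis
      using D0 e by blast
  qed
  have Z0: "orth_proj Z d = 0" if d: "d \<in> D" for d
  proof -
    let ?e = "orth_proj Z d"
    have e: "?e \<in> D" "?e \<in> Z"
      using affiliatedD(3)[OF D central_orth_proj[OF Z invZ] d] orth_proj_in[OF cZ] by auto
    have "\<forall>x\<in>G' \<inter> Z. V (V x) \<in> G' \<inter> Z \<and> norm (V (V x)) = norm x"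
      using VVG' bspec[OF invZ VV] G'L iso by auto
    then have "G' \<inter> Z \<subseteq> (\<lambda>x. V (V x)) ` (G' \<inter> Z)"
      by (rule finD[OF fin2 VV])
    \<comment> \<open>Here \<open>D\<close> enters \<open>G'\<close> only after one application of
      \<open>V\<close>, so surjectivity is used for \<open>V ?e\<close> and one \<open>V\<close> is
      then cancelled.\<close>
    then obtain x where x: "x \<in> G'" "V ?e = V (V x)"
      using VDG'[OF e(1)] bspec[OF bspec[OF invZ V] e(2)] by blast
    have eL: "?e \<in> L" "V x \<in> L"
      using e x G'L iso by (auto simp: D_def)
    then have "norm (V (?e - V x)) = norm (?e - V x)"
      using iso csubspD(4)[OF cL(1)] by blast
    then have "?e = V x"
      using x(2) by (simp add: bounded_opsD(3)[OF Vb])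
    then show ?thesis
      using D0[OF e(1)] x(1) G'L by blast
  qed
  have "d = 0" if d: "d \<in> D" for d
  proof -
    have "d \<in> Z"
      using W0[OF d] orth_proj_eq_zero_iff[OF cW] by (simp add: Z_def)
    then show ?thesis
      using Z0[OF d] orth_proj_id[OF cZ(1)] by metis
  qed
  moreover have "y - orth_proj (V ` L) y \<in> D" if "y \<in> L" for y
    using orth_proj_diff_ocomp[of "V ` L" y] orth_proj_in[of "V ` L" y] affiliatedD(1,2)[OF VL] iso
      csubspD(4)[OF cL(1) that] by (auto simp: D_def image_subset_iff)
  ultimately show "L \<subseteq> V ` L"
    using orth_proj_in[of "V ` L"] affiliatedD(1,2)[OF VL] by (metis right_minus_eq subsetI)
qed

text \<open>On the complement of its kernel within \<open>L\<close> the operator is injective, so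
  this complement inherits finiteness from \<open>L'\<close>; the kernel part is finite by
  hypothesis, and the two are orthogonal summands of \<open>L\<close>.\<close>

lemma fin_extension:
  assumes X: "X \<in> A" and L: "affiliated A L" and L': "fin A L'"
    and into: "\<And>x. x \<in> L \<Longrightarrow> X x \<in> L'" and ker: "fin A (L \<inter> {x. X x = 0})"
  shows "fin A L"
proof (rule fin_orthogonal_sum[OF L ker])
  show "fin A (L \<inter> ocomp (L \<inter> {x. X x = 0}))"
  proof (rule fin_injective[OF X _ L'])
    show "affiliated A (L \<inter> ocomp (L \<inter> {x. X x = 0}))"
      by (intro affiliated_Int affiliated_ocomp affiliated_ker X L)
    fix x assume x: "x \<in> L \<inter> ocomp (L \<inter> {x. X x = 0})"
    then show "X x \<in> L'"
      using into by simp
    assume "X x = 0"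
    then have "cinner x x = 0"
      using x by (auto simp: ocomp_def)
    then show "x = 0"
      by simp
  qed
qed simp

end

section \<open>Fredholm elements and operator matrices\<close>


lemma Baire_ball:
  fixes K :: "nat \<Rightarrow> 'a::{metric_space, complete_space} set"
  assumes closed: "\<And>n. closed (K n)" and cover: "(\<Union>n. K n) = UNIV"
  shows "\<exists>n x r. 0 < r \<and> ball x r \<subseteq> K n"
proof (rule ccontr)
  assume neg: "\<not> ?thesis"
  have empty: "euclidean interior_of K n = {}" for n
  proof (rule ccontr)
    assume "euclidean interior_of K n \<noteq> {}"
    then obtain x where x: "x \<in> euclidean interior_of K n"
      by blast
    have "open (euclidean interior_of K n)"
      by (metis open_openin openin_interior_of)
    then obtain r where r: "0 < r" "ball x r \<subseteq> euclidean interior_of K n"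
      using x open_contains_ball by blast
    have "ball x r \<subseteq> K n"
      using r(2) interior_of_subset[of euclidean "K n"] by (rule order_trans)
    then show False
      using neg r(1) by blast
  qed
  have "Met_TC.mtopology interior_of \<Union>(range K) = {}"
    using closed empty by (intro Met_TC.metric_Baire_category_alt) (auto simp: complete_UNIV)
  then have "euclidean interior_of (UNIV :: 'a set) = {}"
    using cover by simp
  moreover have "euclidean interior_of (UNIV :: 'a set) = UNIV"
    using interior_of_topspace[of "euclidean :: 'a topology"] by simp
  ultimately show False
    by simp
qed

text \<open>Uniform boundedness: the functionals \<open>\<langle>_, y\<rangle>\<close> with \<open>y \<in> J\<close> and \<open>\<parallel>T* y\<parallel> \<le> 1\<close> are
  pointwise bounded because \<open>\<langle>T u, y\<rangle> = \<langle>u, T* y\<rangle>\<close>.\<close>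

lemma adjoint_bounded_below:
  assumes T: "T \<in> bounded_ops" and J: "csubsp J" "closed J"
    and range: "\<And>x. x \<in> J \<Longrightarrow> \<exists>u. \<forall>y\<in>J. cinner x y = cinner (T u) y"
  shows "\<exists>d>0. \<forall>y\<in>J. d * norm y \<le> norm (cadjoint T y)"
proof -
  note Tb = cadjoint_bounded_ops[OF T]
  define B where "B = {y\<in>J. norm (cadjoint T y) \<le> 1}"
  define K where "K n = (\<Inter>y\<in>B. {x. cmod (cinner x y) \<le> real n})" for n :: nat
  have "closed (K n)" for n
    unfolding K_def by (intro closed_INT ballI closed_Collect_le continuous_intros continuous_on_id)
  moreover have "(\<Union>n. K n) = UNIV"
  proof -
    have "x \<in> (\<Union>n. K n)" for x
    proof -
      obtain u where u: "\<forall>y\<in>J. cinner (orth_proj J x) y = cinner (T u) y"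
        using range[OF orth_proj_in[OF J]] by blast
      have "cmod (cinner x y) \<le> norm u" if y: "y \<in> B" for y
      proof -
        have yJ: "y \<in> J" and le: "norm (cadjoint T y) \<le> 1"
          using y by (auto simp: B_def)
        have "cinner x y = cinner u (cadjoint T y)"
          using orth_proj_selfadj[OF J, of x y] orth_proj_id[OF J(1) yJ] u yJ by (simp add: cadjoint(1)[OF T])
        then have "cmod (cinner x y) \<le> norm u * norm (cadjoint T y)"
          using cmod_cinner_le by simp
        also have "\<dots> \<le> norm u * 1"
          by (intro mult_left_mono le) simp
        finally show ?thesis
          by simp
      qed
      moreover obtain n :: nat where "norm u \<le> real n"
        using real_arch_simple by blast
      ultimately have "x \<in> K n"
        unfolding K_def by fastforce
      then show ?thesis
        by blast
    qed
    then show ?thesis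
      by blast
  qed
  ultimately obtain n x r where r: "0 < r" and ball: "ball x r \<subseteq> K n"
    using Baire_ball[of K] by blast
  \<comment> \<open>For \<open>y\<close> in \<open>B\<close>, a multiple \<open>z\<close> of
    \<open>y\<close> with norm \<open>r / 2\<close> keeps \<open>x + z\<close> in the ball. The
    product of \<open>z\<close> and \<open>y\<close> is a difference of two numbers of modulus at
    most \<open>n\<close>, so \<open>r / 2 * norm y\<close> is at most \<open>2 * n\<close>.\<close>
  define M where "M = 4 * real n / r"
  have M: "norm y \<le> M" if y: "y \<in> B" for y
  proof (cases "y = 0")
    case True
    then show ?thesis
      using r by (simp add: M_def)
  next
    case False
    define z where "z = (r / (2 * norm y)) *\<^sub>R y"
    have nz: "norm z = r / 2"
      using False r by (simp add: z_def)
    then have "x + z \<in> K n" "x \<in> K n"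
      using ball r by (auto simp: dist_norm subset_iff)
    then have *: "cmod (cinner (x + z) y) \<le> n" "cmod (cinner x y) \<le> n"
      using y by (auto simp: K_def)
    have "cinner z y = cinner (x + z) y - cinner x y"
      by (simp add: cinner_add_left)
    then have "cmod (cinner z y) \<le> 2 * n"
      using * norm_triangle_ineq4[of "cinner (x + z) y" "cinner x y"] by simp
    moreover have "cinner z y = complex_of_real (r / (2 * norm y) * (norm y)\<^sup>2)"
      unfolding z_def scaleC_of_real[symmetric] cinner_scaleC_left cinner_self by simp
    then have "cmod (cinner z y) = \<bar>r / (2 * norm y) * (norm y)\<^sup>2\<bar>"
      by (simp only: norm_of_real real_norm_def)
    then have "cmod (cinner z y) = r / 2 * norm y"
      using False r by (simp add: power2_eq_square)
    ultimately have "r / 2 * norm y \<le> 2 * n"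
      by simp
    then show ?thesis
      using r by (simp add: M_def field_simps)
  qed
  have M0: "0 \<le> M"
    using r by (simp add: M_def)
  have bound: "norm y \<le> M * norm (cadjoint T y)" if y: "y \<in> J" for y
  proof (rule field_le_epsilon)
    fix e :: real assume e: "0 < e"
    \<comment> \<open>The extra term makes \<open>t\<close> positive even if the adjoint kills
      \<open>y\<close>, which is not yet excluded, and costs at most \<open>e\<close> after
      multiplication by \<open>M\<close>.\<close>
    define t where "t = norm (cadjoint T y) + e / (M + 1)"
    have t: "t > 0" "norm (cadjoint T y) \<le> t"
      using e M0 by (auto simp: t_def intro: add_nonneg_pos)
    then have "(1 / t) *\<^sub>R y \<in> B"
      using y csubspD(6)[OF J(1)] by (simp add: B_def bounded_opsD(7)[OF Tb])
    then have "norm y \<le> M * t"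
      using M[of "(1 / t) *\<^sub>R y"] t by (simp add: field_simps)
    also have "M * t \<le> M * norm (cadjoint T y) + e"
      using e M0 by (simp add: t_def field_simps)
    finally show "norm y \<le> M * norm (cadjoint T y) + e" .
  qed
  have "1 / (M + 1) * norm y \<le> norm (cadjoint T y)" if "y \<in> J" for y
  proof -
    have "norm y \<le> (M + 1) * norm (cadjoint T y)"
      using bound[OF that] norm_ge_zero[of "cadjoint T y"] unfolding distrib_right by linarith
    then show ?thesis
      using M0 by (simp add: field_simps)
  qed
  then show ?thesis
    using M0 by (intro exI[of _ "1 / (M + 1)"]) auto
qed

section \<open>Fredholm elements in terms of subspaces\<close>

context vna
begin

text \<open>The projection onto the complement of \<open>J\<close> is injective on \<open>N\<close>,
  since its kernel is \<open>J\<close>.\<close>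

lemma fin_disjoint:
  assumes J: "affiliated A J" "fin A (ocomp J)" and N: "affiliated A N" and disj: "\<And>x. x \<in> N \<Longrightarrow> x \<in> J \<Longrightarrow> x = 0"
  shows "fin A N"
proof (rule fin_injective[OF diff_mem[OF ident_mem orth_proj_mem[OF J(1)]] N J(2)])
  note cJ = affiliatedD(1,2)[OF J(1)]
  show "x - orth_proj J x \<in> ocomp J" for x
    by (rule orth_proj_diff_ocomp[OF cJ])
  show "x = 0" if "x \<in> N" "x - orth_proj J x = 0" for x
    using disj[OF that(1)] orth_proj_in[OF cJ, of x] that(2) by simp
qed

lemma fredholm_iff:
  assumes X: "X \<in> A"
  shows "fredholm A X \<longleftrightarrow> fin A {x. X x = 0} \<and> (\<exists>J. affiliated A J \<and> fin A (ocomp J) \<and> J \<subseteq> range X)"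
proof -
  have "(\<exists>E. finite_projection A E \<and> range (\<lambda>x. x - E x) \<subseteq> range X) \<longleftrightarrow>
    (\<exists>J. affiliated A J \<and> fin A (ocomp J) \<and> J \<subseteq> range X)"
  proof
    assume "\<exists>E. finite_projection A E \<and> range (\<lambda>x. x - E x) \<subseteq> range X"
    then obtain E where E: "finite_projection A E" and r: "range (\<lambda>x. x - E x) \<subseteq> range X"
      by blast
    have Ep: "E \<in> projections A"
      using E by (simp add: finite_projection_def)
    note L = projections_affiliated(1,2)[OF Ep]
    note cL = affiliatedD(1,2)[OF L(1)]
    have "ocomp (range E) \<subseteq> range X"
    proof
      fix x assume "x \<in> ocomp (range E)"
      then have "E x = 0"
        using orth_proj_zero[OF cL(1)] L(2) by metis
      then have "x = x - E x"
        by simp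
      then show "x \<in> range X"
        using r by blast
    qed
    moreover have "fin A (ocomp (ocomp (range E)))"
      using finite_projection_iff[OF Ep] E ocomp_ocomp[OF cL] by simp
    ultimately show "\<exists>J. affiliated A J \<and> fin A (ocomp J) \<and> J \<subseteq> range X"
      using affiliated_ocomp[OF L(1)] by blast
  next
    assume "\<exists>J. affiliated A J \<and> fin A (ocomp J) \<and> J \<subseteq> range X"
    then obtain J where J: "affiliated A J" "fin A (ocomp J)" "J \<subseteq> range X"
      by blast
    have "finite_projection A (orth_proj (ocomp J))"
      using J finite_projection_orth_proj[OF affiliated_ocomp] by blast
    moreover have "x - orth_proj (ocomp J) x \<in> range X" for x
      using orth_proj_diff_ocomp[OF csubsp_ocomp closed_ocomp, of x J] ocomp_ocomp affiliatedD(1,2)[OF J(1)] J(3) by blast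
    ultimately show "\<exists>E. finite_projection A E \<and> range (\<lambda>x. x - E x) \<subseteq> range X"
      by blast
  qed
  then show ?thesis
    unfolding fredholm_def using X finite_projection_orth_proj[OF affiliated_ker[OF X]] by blast
qed

text \<open>\<open>T T*\<close> is bounded below on \<open>J\<close>, hence \<open>T T* J\<close> is closed, and its orthogonal complement
  meets \<open>J\<close> only in 0.\<close>

lemma cofinite_subspace_of_range:
  assumes T: "T \<in> A" and J: "affiliated A J" "fin A (ocomp J)"
    and d: "0 < d" "\<And>y. y \<in> J \<Longrightarrow> d * norm y \<le> norm (cadjoint T y)"
  shows "\<exists>K. affiliated A K \<and> fin A (ocomp K) \<and> K \<subseteq> range T"
proof -
  note Tb = bounded[OF T] and cJ = affiliatedD(1,2)[OF J(1)]
  define S where "S y = T (cadjoint T y)" for y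
  have S: "S \<in> A"
    unfolding S_def by (rule comp_mem'[OF T cadjoint_mem[OF T]])
  note Sb = bounded[OF S]
  have Sin: "cinner (S x) y = cinner (cadjoint T x) (cadjoint T y)" for x y
    by (simp add: S_def cadjoint(1)[OF Tb])
  have lower: "d\<^sup>2 * norm y \<le> norm (S y)" if y: "y \<in> J" for y
  proof (cases "y = 0")
    case False
    have "(d * norm y)\<^sup>2 \<le> (norm (cadjoint T y))\<^sup>2"
      using d(1) by (intro power_mono d(2)[OF y]) simp
    also have "\<dots> = cmod (cinner (S y) y)"
      by (simp add: Sin cinner_self norm_power)
    also have "\<dots> \<le> norm (S y) * norm y"
      by (rule cmod_cinner_le)
    finally have "norm y * (d\<^sup>2 * norm y) \<le> norm y * norm (S y)"
      by (simp add: power2_eq_square mult_ac)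
    then show ?thesis
      using False by simp
  qed simp
  define K where "K = S ` J"
  have cK: "csubsp K" "closed K"
    unfolding K_def using d(1) lower
    by (auto intro!: csubsp_image[OF Sb cJ(1)] closed_image_bounded_below[OF Sb cJ, of "d\<^sup>2"])
  have "c x \<in> K" if "c \<in> commutant A" "x \<in> K" for c x
    using that affiliatedD(3)[OF J(1) that(1)] by (auto simp: K_def commute[OF that(1) S, symmetric])
  then have K: "affiliated A K"
    using cK by (simp add: affiliated_def)
  have "fin A (ocomp K)"
  proof (rule fin_disjoint[OF J affiliated_ocomp[OF K]])
    fix x assume x: "x \<in> ocomp K" "x \<in> J"
    then have "cinner x (S x) = 0"
      by (auto simp: ocomp_def K_def)
    then have "cinner (S x) x = 0"
      using cinner_eq_zero_commute by blast
    then have "cadjoint T x = 0"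
      by (simp add: Sin)
    then show "x = 0"
      using d(1) d(2)[OF x(2)] by (simp add: mult_le_0_iff)
  qed
  moreover have "K \<subseteq> range T"
    by (auto simp: K_def S_def)
  ultimately show ?thesis
    using K by blast
qed

end

section \<open>The von Neumann algebra of operator matrices\<close>

lemma op_matrix_bounded_ops:
  assumes "X \<in> bounded_ops" "Y \<in> bounded_ops" "Z \<in> bounded_ops" "W \<in> bounded_ops"
  shows "op_matrix X Y Z W \<in> bounded_ops"
proof -
  have "bounded_linear (\<lambda>p. (X (fst p) + Y (snd p), Z (fst p) + W (snd p)))"
    using assms[THEN bounded_opsD(1)]
    by (intro bounded_linear_Pair bounded_linear_add)
      (auto intro: bounded_linear_compose bounded_linear_fst bounded_linear_snd)
  then show ?thesis
    by (simp add: bounded_ops_def op_matrix_def case_prod_unfold scaleC_prod_def scaleC_add_right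
        bounded_opsD(6)[OF assms(1)] bounded_opsD(6)[OF assms(2)] bounded_opsD(6)[OF assms(3)] bounded_opsD(6)[OF assms(4)])
qed

lemma cadjoint_op_matrix:
  assumes "X \<in> bounded_ops" "Y \<in> bounded_ops" "Z \<in> bounded_ops" "W \<in> bounded_ops"
  shows "cadjoint (op_matrix X Y Z W) = op_matrix (cadjoint X) (cadjoint Z) (cadjoint Y) (cadjoint W)"
  by (rule cadjoint_unique)
    (simp add: op_matrix_def case_prod_unfold cinner_prod_def cinner_simps
      cadjoint(1)[OF assms(1)] cadjoint(1)[OF assms(2)] cadjoint(1)[OF assms(3)] cadjoint(1)[OF assms(4)])

lemma op_matrix_apply: "op_matrix X Y Z W (x, y) = (X x + Y y, Z x + W y)"
  by (simp add: op_matrix_def)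

context vna
begin

lemma op_matrix_mem:
  "X \<in> A \<Longrightarrow> Y \<in> A \<Longrightarrow> Z \<in> A \<Longrightarrow> W \<in> A \<Longrightarrow> op_matrix X Y Z W \<in> matrix_algebra A"
  by (auto simp: matrix_algebra_def)

lemma matrix_algebraE:
  assumes "M \<in> matrix_algebra A"
  obtains X Y Z W where "M = op_matrix X Y Z W" "X \<in> A" "Y \<in> A" "Z \<in> A" "W \<in> A"
  using assms by (auto simp: matrix_algebra_def)

lemma diagonal_commutant:
  assumes c: "c \<in> commutant A"
  shows "op_matrix c (\<lambda>_. 0) (\<lambda>_. 0) c \<in> commutant (matrix_algebra A)"
proof -
  note cb = commutant_bounded[OF c]
  have "op_matrix c (\<lambda>_. 0) (\<lambda>_. 0) c \<in> bounded_ops"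
    by (intro op_matrix_bounded_ops cb bounded zero_mem)
  moreover have "op_matrix c (\<lambda>_. 0) (\<lambda>_. 0) c \<circ> M = M \<circ> op_matrix c (\<lambda>_. 0) (\<lambda>_. 0) c"
    if M: "M \<in> matrix_algebra A" for M
    using M by (elim matrix_algebraE)
      (auto simp: fun_eq_iff op_matrix_apply bounded_opsD(2)[OF cb] commute[OF c])
  ultimately show ?thesis
    by (simp add: commutant_def)
qed

lemma star_subalgebra_matrix: "star_subalgebra (matrix_algebra A)"
  unfolding star_subalgebra_def
proof (intro conjI ballI allI subsetI)
  show "M \<in> bounded_ops" if "M \<in> matrix_algebra A" for M
    using that by (auto elim!: matrix_algebraE intro!: op_matrix_bounded_ops bounded)
  have "id = op_matrix id (\<lambda>_. 0) (\<lambda>_. 0) id"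
    by (auto simp: op_matrix_def)
  then show "id \<in> matrix_algebra A"
    using op_matrix_mem[OF id_mem zero_mem zero_mem id_mem] by metis
  fix M assume "M \<in> matrix_algebra A"
  then obtain X Y Z W where M: "M = op_matrix X Y Z W" "X \<in> A" "Y \<in> A" "Z \<in> A" "W \<in> A"
    by (rule matrix_algebraE)
  have "(\<lambda>p. c *\<^sub>C M p) = op_matrix (\<lambda>x. c *\<^sub>C X x) (\<lambda>x. c *\<^sub>C Y x) (\<lambda>x. c *\<^sub>C Z x) (\<lambda>x. c *\<^sub>C W x)" for c
    by (auto simp: M(1) op_matrix_def scaleC_prod_def scaleC_add_right)
  then show "(\<lambda>p. c *\<^sub>C M p) \<in> matrix_algebra A" for c
    using M by (simp add: op_matrix_mem scaleC_mem)
  show "cadjoint M \<in> matrix_algebra A"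
    using M by (simp add: cadjoint_op_matrix bounded op_matrix_mem cadjoint_mem)
  fix N assume "N \<in> matrix_algebra A"
  then obtain X' Y' Z' W' where N: "N = op_matrix X' Y' Z' W'" "X' \<in> A" "Y' \<in> A" "Z' \<in> A" "W' \<in> A"
    by (rule matrix_algebraE)
  have "(\<lambda>p. M p + N p) = op_matrix (\<lambda>x. X x + X' x) (\<lambda>x. Y x + Y' x) (\<lambda>x. Z x + Z' x) (\<lambda>x. W x + W' x)"
    by (auto simp: M(1) N(1) op_matrix_def)
  then show "(\<lambda>p. M p + N p) \<in> matrix_algebra A"
    using M N by (simp add: op_matrix_mem add_mem)
  have "M \<circ> N = op_matrix (\<lambda>x. X (X' x) + Y (Z' x)) (\<lambda>x. X (Y' x) + Y (W' x))
      (\<lambda>x. Z (X' x) + W (Z' x)) (\<lambda>x. Z (Y' x) + W (W' x))"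
    using M by (auto simp: N(1) op_matrix_apply bounded_opsD(2)[OF bounded])
  then show "M \<circ> N \<in> matrix_algebra A"
    using M N by (simp add: op_matrix_mem add_mem comp_mem')
qed

text \<open>The diagonal matrices with an element \<open>c\<close> of the commutant in both places
  suffice as test elements: an operator commuting with them has entries commuting with every
  \<open>c\<close>, so the entries lie in the bicommutant of \<open>A\<close>.\<close>

lemma von_neumann_algebra_matrix: "von_neumann_algebra (matrix_algebra A)"
  unfolding von_neumann_algebra_def
proof (intro conjI star_subalgebra_matrix subset_antisym subsetI)
  fix M assume M: "M \<in> matrix_algebra A"
  then have "M \<in> bounded_ops"
    using star_subalgebra_matrix by (auto simp: star_subalgebra_def)
  then show "M \<in> commutant (commutant (matrix_algebra A))"
    using M by (auto simp: commutant_def)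
next
  fix M assume M: "M \<in> commutant (commutant (matrix_algebra A))"
  then have Mb: "M \<in> bounded_ops"
    by (simp add: commutant_def)
  have Mc: "M (c x, c y) = (c (fst (M (x, y))), c (snd (M (x, y))))" if c: "c \<in> commutant A" for c x y
  proof -
    have "M \<circ> op_matrix c (\<lambda>_. 0) (\<lambda>_. 0) c = op_matrix c (\<lambda>_. 0) (\<lambda>_. 0) c \<circ> M"
      using M diagonal_commutant[OF c] by (simp add: commutant_def[of "commutant (matrix_algebra A)"])
    from fun_cong[OF this, of "(x, y)"] show ?thesis
      by (simp add: op_matrix_def case_prod_unfold)
  qed
  have entry: "(\<lambda>x. p (M (i x))) \<in> A"
    if p: "bounded_linear p" "\<And>c z. p (c *\<^sub>C z) = c *\<^sub>C p z" and i: "bounded_linear i" "\<And>c x. i (c *\<^sub>C x) = c *\<^sub>C i x"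
      and comm: "\<And>c x. c \<in> commutant A \<Longrightarrow> p (M (i (c x))) = c (p (M (i x)))"
    for p :: "'h \<times> 'h \<Rightarrow> 'h" and i :: "'h \<Rightarrow> 'h \<times> 'h"
  proof (rule memI)
    have "bounded_linear (\<lambda>x. p (M (i x)))"
      by (rule bounded_linear_compose[OF p(1) bounded_linear_compose[OF bounded_opsD(1)[OF Mb] i(1)]])
    then show "(\<lambda>x. p (M (i x))) \<in> bounded_ops"
      by (simp add: bounded_ops_def p i bounded_opsD(6)[OF Mb])
  qed (rule comm)
  have l: "bounded_linear (\<lambda>x::'h. (x, 0::'h))" "bounded_linear (\<lambda>x::'h. (0::'h, x))"
    by (intro bounded_linear_Pair bounded_linear_ident bounded_linear_zero)+
  have c0: "c 0 = 0" if "c \<in> commutant A" for c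
    using bounded_opsD(5)[OF commutant_bounded[OF that]] .
  have m: "(\<lambda>x. fst (M (x, 0))) \<in> A" "(\<lambda>x. snd (M (x, 0))) \<in> A"
    "(\<lambda>x. fst (M (0, x))) \<in> A" "(\<lambda>x. snd (M (0, x))) \<in> A"
    using Mc[of _ _ 0] Mc[of _ 0]
    by (auto intro!: entry bounded_linear_fst bounded_linear_snd l simp: scaleC_prod_def c0)
  have "M = op_matrix (\<lambda>x. fst (M (x, 0))) (\<lambda>x. fst (M (0, x))) (\<lambda>x. snd (M (x, 0))) (\<lambda>x. snd (M (0, x)))"
  proof
    fix p
    show "M p = op_matrix (\<lambda>x. fst (M (x, 0))) (\<lambda>x. fst (M (0, x))) (\<lambda>x. snd (M (x, 0))) (\<lambda>x. snd (M (0, x))) p"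
      using bounded_opsD(2)[OF Mb, of "(fst p, 0)" "(0, snd p)"]
      by (simp add: op_matrix_def case_prod_unfold prod_eq_iff)
  qed
  then show "M \<in> matrix_algebra A"
    using op_matrix_mem[OF m(1,3,2,4)] by simp
qed

interpretation mat: vna "matrix_algebra A"
  by unfold_locales (rule von_neumann_algebra_matrix)

text \<open>Both subspaces are kernels of elements of the matrix algebra, so its full commutant need
  not be determined.\<close>

lemma affiliated_corners:
  assumes L: "affiliated A L"
  shows "affiliated (matrix_algebra A) (L \<times> {0})" "affiliated (matrix_algebra A) ({0} \<times> L)"
proof -
  note cL = affiliatedD(1,2)[OF L]
  have d: "(\<lambda>x. x - orth_proj L x) \<in> A"
    by (rule diff_mem[OF ident_mem orth_proj_mem[OF L]])
  have eq: "x - orth_proj L x = 0 \<longleftrightarrow> x \<in> L" for x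
    using orth_proj_id[OF cL(1)] orth_proj_in[OF cL, of x] by auto
  have "{p. op_matrix (\<lambda>x. x - orth_proj L x) (\<lambda>_. 0) (\<lambda>_. 0) (\<lambda>x. x) p = 0} = L \<times> {0}"
    "{p. op_matrix (\<lambda>x. x) (\<lambda>_. 0) (\<lambda>_. 0) (\<lambda>x. x - orth_proj L x) p = 0} = {0} \<times> L"
    by (simp_all add: set_eq_iff op_matrix_apply zero_prod_def eq del: right_minus_eq)
  then show "affiliated (matrix_algebra A) (L \<times> {0})" "affiliated (matrix_algebra A) ({0} \<times> L)"
    using mat.affiliated_ker[OF op_matrix_mem[OF d zero_mem zero_mem ident_mem]]
      mat.affiliated_ker[OF op_matrix_mem[OF ident_mem zero_mem zero_mem d]] by simp_all
qed

lemma affiliated_slices: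
  assumes J: "affiliated (matrix_algebra A) J"
  shows "affiliated A {x. (x, 0) \<in> J}" "affiliated A {y. (0, y) \<in> J}"
proof -
  note cJ = affiliatedD(1,2)[OF J]
  have cl: "closed {x. (x, 0) \<in> J}" "closed {y. (0, y) \<in> J}"
    using closed_vimage[OF cJ(2), of "\<lambda>x. (x, 0)"] closed_vimage[OF cJ(2), of "\<lambda>x. (0, x)"]
    by (auto simp: vimage_def continuous_on_Pair)
  have c: "(c x, c y) \<in> J" if "c \<in> commutant A" "(x, y) \<in> J" for c x y
    using affiliatedD(3)[OF J diagonal_commutant[OF that(1)] that(2)] by (simp add: op_matrix_apply)
  have c0: "c 0 = 0" if "c \<in> commutant A" for c
    using bounded_opsD(5)[OF commutant_bounded[OF that]] .
  have c': "(x, 0) \<in> J \<Longrightarrow> (c x, 0) \<in> J" "(0, x) \<in> J \<Longrightarrow> (0, c x) \<in> J" if "c \<in> commutant A" for c x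
    using c[OF that, of x 0] c[OF that, of 0 x] c0[OF that] by simp_all
  have "csubsp {x. (x, 0) \<in> J}" "csubsp {y. (0, y) \<in> J}"
    using csubspD(1)[OF cJ(1)] csubspD(2)[OF cJ(1), of "(_, _)" "(_, _)"] csubspD(3)[OF cJ(1), of "(_, _)"]
    by (fastforce simp: csubsp_def zero_prod_def scaleC_prod_def)+
  then show "affiliated A {x. (x, 0) \<in> J}" "affiliated A {y. (0, y) \<in> J}"
    using cl c' by (auto simp: affiliated_def)
qed

lemma fin_corner1:
  assumes L: "affiliated A L" and f: "fin (matrix_algebra A) (L \<times> {0})"
  shows "fin A L"
  unfolding fin_def
proof (intro conjI L ballI impI subsetI)
  fix V x assume V: "V \<in> A" and iso: "\<forall>x\<in>L. V x \<in> L \<and> norm (V x) = norm x" and x: "x \<in> L"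
  have "L \<times> {0} \<subseteq> op_matrix V (\<lambda>_. 0) (\<lambda>_. 0) (\<lambda>_. 0) ` (L \<times> {0})"
    using iso by (intro finD[OF f op_matrix_mem[OF V zero_mem zero_mem zero_mem]])
      (auto simp: op_matrix_apply norm_Pair)
  then have "(x, 0) \<in> op_matrix V (\<lambda>_. 0) (\<lambda>_. 0) (\<lambda>_. 0) ` (L \<times> {0})"
    using x by blast
  then show "x \<in> V ` L"
    by (auto simp: op_matrix_apply)
qed

lemma fin_corner2:
  assumes L: "affiliated A L" and f: "fin (matrix_algebra A) ({0} \<times> L)"
  shows "fin A L"
  unfolding fin_def
proof (intro conjI L ballI impI subsetI)
  fix V x assume V: "V \<in> A" and iso: "\<forall>x\<in>L. V x \<in> L \<and> norm (V x) = norm x" and x: "x \<in> L"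
  have "{0} \<times> L \<subseteq> op_matrix (\<lambda>_. 0) (\<lambda>_. 0) (\<lambda>_. 0) V ` ({0} \<times> L)"
    using iso by (intro finD[OF f op_matrix_mem[OF zero_mem zero_mem zero_mem V]])
      (auto simp: op_matrix_apply norm_Pair)
  then have "(0, x) \<in> op_matrix (\<lambda>_. 0) (\<lambda>_. 0) (\<lambda>_. 0) V ` ({0} \<times> L)"
    using x by blast
  then show "x \<in> V ` L"
    by (auto simp: op_matrix_apply)
qed

section \<open>Fredholm triangular matrices\<close>

text \<open>For the range, \<open>(0, y)\<close> in the range of the matrix puts \<open>y\<close> in
  the range of \<open>S\<close>, so the slice \<open>K\<close> of \<open>J\<close> serves;
  \<open>{0} \<times> ocomp K\<close> meets \<open>J\<close> only in 0, which makes
  \<open>ocomp K\<close> finite. For the kernel, \<open>fin_extension\<close> is applied to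
  \<open>X\<close>, which is \<open>C\<close> followed by the projection onto
  \<open>ocomp I\<close>.\<close>

lemma fredholm_lower_entry:
  assumes T: "T \<in> A" and S: "S \<in> A" and C: "C \<in> A"
    and fT: "fredholm A T" and fM: "fredholm (matrix_algebra A) (op_matrix T C (\<lambda>_. 0) S)"
  shows "fredholm A S"
proof -
  let ?M = "op_matrix T C (\<lambda>_. 0) S"
  have M: "?M \<in> matrix_algebra A"
    by (rule op_matrix_mem[OF T C zero_mem S])
  obtain J where kM: "fin (matrix_algebra A) {p. ?M p = 0}" and J: "affiliated (matrix_algebra A) J"
    "fin (matrix_algebra A) (ocomp J)" "J \<subseteq> range ?M"
    using fM mat.fredholm_iff[OF M] by blast
  obtain I where I: "affiliated A I" "fin A (ocomp I)" "I \<subseteq> range T"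
    using fT fredholm_iff[OF T] by blast
  note cI = affiliatedD(1,2)[OF I(1)]
  define K where "K = {y. (0, y) \<in> J}"
  have K: "affiliated A K"
    unfolding K_def by (rule affiliated_slices(2)[OF J(1)])
  have "fin (matrix_algebra A) ({0} \<times> ocomp K)"
  proof (rule mat.fin_disjoint[OF J(1,2) affiliated_corners(2)[OF affiliated_ocomp[OF K]]])
    fix p assume "p \<in> {0} \<times> ocomp K" "p \<in> J"
    then have "cinner (snd p) (snd p) = 0" "fst p = 0"
      by (auto simp: K_def ocomp_def)
    then show "p = 0"
      by (simp add: prod_eq_iff)
  qed
  then have fK: "fin A (ocomp K)"
    by (rule fin_corner2[OF affiliated_ocomp[OF K]])
  have "K \<subseteq> range S"
    using J(3) by (auto simp: K_def op_matrix_def)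
  define N where "N = {y. S y = 0}"
  have N: "affiliated A N"
    unfolding N_def by (rule affiliated_ker[OF S])
  define X where "X y = C y - orth_proj I (C y)" for y
  have X: "X \<in> A"
    unfolding X_def by (rule diff_mem[OF C comp_mem'[OF orth_proj_mem[OF I(1)] C]])
  define N0 where "N0 = N \<inter> {y. X y = 0}"
  have N0: "affiliated A N0"
    unfolding N0_def by (rule affiliated_Int[OF N affiliated_ker[OF X]])
  note aM = mat.affiliated_ker[OF M]
  note cM = affiliatedD(1,2)[OF aM]
  have "fin (matrix_algebra A) ({0} \<times> N0)"
  \<comment> \<open>A preimage \<open>x\<close> of \<open>C y\<close> under \<open>T\<close> is not
    given by an operator of the algebra, so \<open>y\<close> is not sent to \<open>(- x, y)\<close>.
    Projecting \<open>(0, y)\<close> onto the kernel of the matrix is still injective, because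
    \<open>(0, y)\<close> and \<open>(- x, y)\<close> have inner product
    \<open>cinner y y\<close>.\<close>
  proof (rule mat.fin_injective[OF mat.orth_proj_mem[OF aM] affiliated_corners(2)[OF N0] kM orth_proj_in[OF cM]])
    fix p assume p: "p \<in> {0} \<times> N0" and "orth_proj {p. ?M p = 0} p = 0"
    then have orth: "cinner p q = 0" if "?M q = 0" for q
      using that unfolding orth_proj_eq_zero_iff[OF cM] ocomp_def by blast
    obtain y where y: "p = (0, y)" "S y = 0" "X y = 0"
      using p by (auto simp: N0_def N_def)
    have "C y \<in> I"
      using y(3) orth_proj_in[OF cI, of "C y"] by (simp add: X_def)
    then obtain x where "T x = C y"
      using I(3) by auto
    then have "?M (- x, y) = 0"
      by (simp add: op_matrix_apply y bounded_opsD(4)[OF bounded[OF T]] zero_prod_def)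
    then have "cinner y y = 0"
      using orth[of "(- x, y)"] by (simp add: y(1) cinner_prod_def)
    then show "p = 0"
      by (simp add: y(1) zero_prod_def)
  qed
  then have "fin A (N \<inter> {y. X y = 0})"
    using fin_corner2[OF N0] by (simp add: N0_def)
  then have "fin A N"
    using fin_extension[OF X N I(2)] orth_proj_diff_ocomp[OF cI] by (simp add: X_def)
  then show ?thesis
    using fredholm_iff[OF S] K fK \<open>K \<subseteq> range S\<close> by (auto simp: N_def)
qed

text \<open>A vector of the slice \<open>L\<close> has the form \<open>T u + C v\<close> with
  \<open>v\<close> in the finite kernel \<open>N\<close> of \<open>S\<close>. To remove
  \<open>C v\<close>, the slice is cut down to the vectors orthogonal to the image of
  \<open>N\<close> under \<open>C\<close>; those form the kernel of \<open>X\<close> in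
  \<open>L\<close>. This loses only a finite subspace, and on \<open>I\<close> the vector
  \<open>T u\<close> has the same inner products as the given one, which is what
  \<open>adjoint_bounded_below\<close> asks for.\<close>

lemma fredholm_upper_entry:
  assumes T: "T \<in> A" and S: "S \<in> A" and C: "C \<in> A"
    and fS: "fredholm A S" and fM: "fredholm (matrix_algebra A) (op_matrix T C (\<lambda>_. 0) S)"
  shows "fredholm A T"
proof -
  let ?M = "op_matrix T C (\<lambda>_. 0) S"
  have M: "?M \<in> matrix_algebra A"
    by (rule op_matrix_mem[OF T C zero_mem S])
  note Tb = bounded[OF T] and Sb = bounded[OF S] and Cb = bounded[OF C]
  obtain J where kM: "fin (matrix_algebra A) {p. ?M p = 0}" and J: "affiliated (matrix_algebra A) J"
    "fin (matrix_algebra A) (ocomp J)" "J \<subseteq> range ?M"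
    using fM mat.fredholm_iff[OF M] by blast
  define N where "N = {y. S y = 0}"
  have fN: "fin A N"
    unfolding N_def using fS fredholm_iff[OF S] by blast
  then have N: "affiliated A N"
    by (simp add: fin_def)
  note cN = affiliatedD(1,2)[OF N]
  have aT: "affiliated A {x. T x = 0}"
    by (rule affiliated_ker[OF T])
  have "fin (matrix_algebra A) ({x. T x = 0} \<times> {0})"
    by (rule mat.fin_mono[OF kM affiliated_corners(1)[OF aT]])
      (auto simp: op_matrix_apply zero_prod_def bounded_opsD(5)[OF Cb] bounded_opsD(5)[OF Sb])
  then have kT: "fin A {x. T x = 0}"
    by (rule fin_corner1[OF aT])
  define L where "L = {x. (x, 0) \<in> J}"
  have L: "affiliated A L"
    unfolding L_def by (rule affiliated_slices(1)[OF J(1)])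
  have "fin (matrix_algebra A) (ocomp L \<times> {0})"
  proof (rule mat.fin_disjoint[OF J(1,2) affiliated_corners(1)[OF affiliated_ocomp[OF L]]])
    fix p assume "p \<in> ocomp L \<times> {0}" "p \<in> J"
    then have "cinner (fst p) (fst p) = 0" "snd p = 0"
      by (auto simp: L_def ocomp_def)
    then show "p = 0"
      by (simp add: prod_eq_iff)
  qed
  then have fL: "fin A (ocomp L)"
    by (rule fin_corner1[OF affiliated_ocomp[OF L]])
  note cL = affiliatedD(1,2)[OF L]
  define X where "X y = orth_proj N (cadjoint C y)" for y
  have X: "X \<in> A"
    unfolding X_def by (rule comp_mem'[OF orth_proj_mem[OF N] cadjoint_mem[OF C]])
  define I where "I = L \<inter> {x. X x = 0}"
  have I: "affiliated A I"
    unfolding I_def by (rule affiliated_Int[OF L affiliated_ker[OF X]])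
  note cI = affiliatedD(1,2)[OF I] and aI = affiliated_ocomp[OF I]
  have P: "(\<lambda>x. x - orth_proj L x) \<in> A"
    by (rule diff_mem[OF ident_mem orth_proj_mem[OF L]])
  \<comment> \<open>First half of an extension argument for \<open>ocomp I\<close>: the part inside
    \<open>L\<close> embeds into \<open>N\<close> by \<open>X\<close>, and the rest is carried into
    the finite \<open>ocomp L\<close> by the projection \<open>P\<close>.\<close>
  have "fin A (ocomp I \<inter> {x. x - orth_proj L x = 0})"
  proof (rule fin_injective[OF X affiliated_Int[OF aI affiliated_ker[OF P]] fN])
    show "X x \<in> N" for x
      unfolding X_def by (rule orth_proj_in[OF cN])
    fix x assume x: "x \<in> ocomp I \<inter> {x. x - orth_proj L x = 0}" and "X x = 0"
    then have "x \<in> I"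
      using orth_proj_in[OF cL, of x] by (simp add: I_def)
    then have "cinner x x = 0"
      using x by (simp add: ocomp_def)
    then show "x = 0"
      by simp
  qed
  then have fI: "fin A (ocomp I)"
    by (rule fin_extension[OF P aI fL orth_proj_diff_ocomp[OF cL]])
  \<comment> \<open>Only inner products against \<open>I\<close> are matched; \<open>x\<close>
    itself need not lie in the range of \<open>T\<close>.\<close>
  have "\<exists>u. \<forall>y\<in>I. cinner x y = cinner (T u) y" if x: "x \<in> I" for x
  proof -
    have "(x, 0) \<in> range ?M"
      using x J(3) by (auto simp: I_def L_def)
    then obtain u v where uv: "x = T u + C v" "S v = 0"
      by (auto simp: op_matrix_apply)
    have "cinner (C v) y = 0" if "y \<in> I" for y
    proof -
      have "cinner (C v) y = cinner v (X y)"
        using uv(2) orth_proj_selfadj[OF cN, of v "cadjoint C y"] orth_proj_id[OF cN(1), of v]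
        by (simp add: X_def N_def cadjoint(1)[OF Cb])
      then show ?thesis
        using that by (simp add: I_def)
    qed
    then show ?thesis
      by (intro exI[of _ u]) (simp add: uv(1) cinner_add_left)
  qed
  then obtain d where "0 < d" "\<And>y. y \<in> I \<Longrightarrow> d * norm y \<le> norm (cadjoint T y)"
    using adjoint_bounded_below[OF Tb cI] by blast
  then have "\<exists>K. affiliated A K \<and> fin A (ocomp K) \<and> K \<subseteq> range T"
    by (rule cofinite_subspace_of_range[OF T I fI])
  then show ?thesis
    using fredholm_iff[OF T] kT by simp
qed

end

theorem proposition4p1:
  fixes A :: "('h::chilbert_space \<Rightarrow> 'h) set"
    and T S C :: "'h \<Rightarrow> 'h"
  assumes "von_neumann_algebra A"
    and "properly_infinite A"
    and "T \<in> A" and "S \<in> A" and "C \<in> A"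
    and "sigma_ef (matrix_algebra A) (op_matrix T C (\<lambda>_. 0) S) \<subset> sigma_ef A T \<union> sigma_ef A S"
  shows "sigma_ef A T \<union> sigma_ef A S =
         sigma_ef (matrix_algebra A) (op_matrix T C (\<lambda>_. 0) S) \<union> (sigma_ef A T \<inter> sigma_ef A S)"
proof -
  interpret vna A
    by unfold_locales (rule assms(1))
  have shift: "(\<lambda>x. X x - l *\<^sub>C x) \<in> A" if "X \<in> A" for X l
    by (rule diff_mem[OF that scaleC_mem[OF ident_mem]])
  \<comment> \<open>Subtracting a scalar changes only the diagonal entries, so the two implications
    apply to the shifted matrix with the same \<open>C\<close>.\<close>
  have "(\<lambda>p. op_matrix T C (\<lambda>_. 0) S p - l *\<^sub>C p)
      = op_matrix (\<lambda>x. T x - l *\<^sub>C x) C (\<lambda>_. 0) (\<lambda>x. S x - l *\<^sub>C x)" for l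
    by (auto simp: op_matrix_def scaleC_prod_def)
  then have "l \<in> sigma_ef A T \<and> l \<in> sigma_ef A S"
    if "l \<in> sigma_ef A T \<union> sigma_ef A S" "l \<notin> sigma_ef (matrix_algebra A) (op_matrix T C (\<lambda>_. 0) S)" for l
    using that fredholm_lower_entry[OF shift[OF assms(3)] shift[OF assms(4)] assms(5), of l l]
      fredholm_upper_entry[OF shift[OF assms(3)] shift[OF assms(4)] assms(5), of l l]
    by (auto simp: sigma_ef_def)
  then show ?thesis
    using assms(6) by blast
qed

end
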